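(* Assume: $p(\cdot\,|x,a)$ is continuous in $(x,a)\in\mathsf X\times\mathsf A$ with respect to total variation distance; there exist a probability measure $\lambda$ on $\mathsf X$, a constant $\alpha_0\in(0,1)$ and a bounded measurable $\phi:\mathsf X\times\mathsf A\to\mathbb R$ such that $p(D|x,a)\ge\lambda(D)\phi(x,a)$ for all Borel $D\subset\mathsf X$ and $1-\alpha_0\le\phi(x,a)$, for all $(x,a)$; $c(\cdot,a)$ is $K_c$-Lipschitz and $d_l(\cdot,a)$ is $K_l$-Lipschitz on $\mathsf X$ for all $a\in\mathsf A$ and $l=1,\dots,q$; and $\|p(\cdot\,|x,a)-p(\cdot\,|y,a)\|_{TV}\le G_p\,d_{\mathsf X}(x,y)$ for all $x,y\in\mathsf X$, $a\in\mathsf A$. Put $K=2\|c\|/\min_{l}\alpha'_l>0$ and consider the average cost criterion. Given any $\kappa>0$ such that $\varepsilon:=\frac{\kappa}{3K}<\frac12\min_{l}\alpha'_l$, let $n$ satisfy $$\frac{\kappa}{3}\ge2\varepsilon_c(n)+\max\{2K,1\}\,\varepsilon_{\max}(n).$$ If $\overline\varphi_n$ is an optimal policy for $(\overline{\mathbf{CP}}_n^{\mathbf k-\varepsilon\mathbf 1})$ obtained by extending to $\mathsf X$ an optimal policy $\varphi_n\in\Phi_n$ for $(\mathbf{CP}_n^{\mathbf k-\varepsilon\mathbf 1})$, then $\overline\varphi_n\in\Phi$ is feasible for $(\mathbf{CP}^{\mathbf k})$ and its true cost $V(\overline\varphi_n,\gamma)$ is within $\kappa$ of the optimal value of $(\mathbf{CP}^{\mathbf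 k})$.
   Context: **Model.** $\mathsf X$ (states) is a compact subset of $\mathbb R^d$, $d\ge1$, with Euclidean distance $d_{\mathsf X}$; $\mathsf A$ (actions) is a compact metric space; every action is admissible in every state. $p(\cdot\,|x,a)$ is a stochastic kernel on $\mathsf X$ given $\mathsf X\times\mathsf A$; $c,d_1,\dots,d_q:\mathsf X\times\mathsf A\to[0,\infty)$ are continuous; $\gamma$ is a probability measure on $\mathsf X$ (initial distribution); $\mathbf k=(k_1,\dots,k_q)\in[0,\infty)^q$; $\mathbf 1=(1,\dots,1)\in\mathbb R^q$. A policy $\pi=\{\pi_t\}$ is a sequence of stochastic kernels on $\mathsf A$ given the history spaces $\mathsf H_t=(\mathsf X\times\mathsf A)^t\times\mathsf X$; $\Pi$ is the set of all policies; $\Phi$ is the set of stochastic kernels on $\mathsf A$ given $\mathsf X$ (randomized stationary policies). $\mathbb E_\gamma^\pi$ is expectation under the law of $(X_t,A_t)_{t\ge0}$ determined by $\gamma$, $\pi$, $p$. $\|\cdot\|$ is the sup norm; $\|\mu\|_{TV}=\sup\{|\int g\,d\mu|:\|g\|\le1\}$ for signed measures. **Average criterion.** $V(\pi,\gamma)=\limsup_{T\to\infty}\frac1T\mathbb E_\gamma^\pi[\sum_{t=0}^{T-1}c(X_t,A_t)]$, and $V_l(\pi,\gamma)$ is the same with $d_l$ in place of $c$. For $\mathbf m\in\mathbb R^q$, $(\mathbf{CP}^{\mathbf m})$: minimize $V(\pi,\gamma)$ over $\pi\in\Pi$ subject to $V_l(\pi,\gamma)\le m_l$, $l=1,\dots,q$.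 Standing assumption: there are $\pi\in\Pi$ and $\boldsymbol\alpha'=(\alpha_1',\dots,\alpha_q')$ with all $\alpha'_l>0$ such that $V_l(\pi,\gamma)+\alpha'_l=k_l$ for all $l$; this $\boldsymbol\alpha'$ is fixed. **Finite models.** $\alpha>0$ is a constant and, for each $n\ge1$, $\mathsf X_n=\{x_{n,1},\dots,x_{n,n}\}\subset\mathsf X$ is a set of cardinality $n$ with $\max_{x\in\mathsf X}\min_{y\in\mathsf X_n}d_{\mathsf X}(x,y)\le\alpha(1/n)^{1/d}$. $Q_n:\mathsf X\to\mathsf X_n$ is a nearest-point map (ties broken so that $Q_n$ is measurable); $\mathcal S_{n,i}=Q_n^{-1}(x_{n,i})$; $i_n(x)$ is the index with $x\in\mathcal S_{n,i_n(x)}$. $\nu_n$ is a finite measure on $\mathsf X$ with $\nu_n(\mathcal S_{n,i})>0$ for all $i$, and $\nu_{n,i}(\cdot)=\nu_n(\cdot)/\nu_n(\mathcal S_{n,i})$ on $\mathcal S_{n,i}$. MDP$_n$ has state space $\mathsf X_n$, action space $\mathsf A$, initial distribution $\gamma_n=\gamma\circ Q_n^{-1}$, and $p_n(x_{n,j}|x_{n,i},a)=\int_{\mathcal S_{n,i}}p(\mathcal S_{n,j}|x,a)\,\nu_{n,i}(dx)$, $c_n(x_{n,i},a)=\int_{\mathcal S_{n,i}}c(x,a)\,\nu_{n,i}(dx)$, $d_{l,n}(x_{n,i},a)=\int_{\mathcal S_{n,i}}d_l(x,a)\,\nu_{n,i}(dx)$. Its policies $\Pi_n$, randomized stationary policies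 $\Phi_n$ and average costs $V_n,V_{l,n}$ are defined as for the original model. $(\mathbf{CP}_n^{\mathbf m})$: minimize $V_n(\pi,\gamma_n)$ over $\pi\in\Pi_n$ subject to $V_{l,n}(\pi,\gamma_n)\le m_l$ for all $l$. The extension of $\varphi\in\Phi_n$ to $\mathsf X$ is $\overline\varphi\in\Phi$, $\overline\varphi(\cdot|x)=\varphi(\cdot|Q_n(x))$. **The model $\overline{\text{MDP}}_n$** has state space $\mathsf X$, action space $\mathsf A$, initial distribution $\gamma$, transition kernel $q_n(\cdot|x,a)=\int p(\cdot|z,a)\,\nu_{n,i_n(x)}(dz)$, cost $b_n(x,a)=\int c(z,a)\,\nu_{n,i_n(x)}(dz)$ and constraint functions $r_{l,n}(x,a)=\int d_l(z,a)\,\nu_{n,i_n(x)}(dz)$. $(\overline{\mathbf{CP}}_n^{\mathbf m})$: minimize over $\pi\in\Pi$ the average cost of $b_n$ in $\overline{\text{MDP}}_n$ subject to the average cost of $r_{l,n}$ in $\overline{\text{MDP}}_n$ being at most $m_l$ for all $l$. **Ergodicity constants.** For $\varphi\in\Phi$, $p(\cdot|x,\varphi)=\int_{\mathsf A}p(\cdot|x,a)\varphi(da|x)$, with $t$-step kernel $p^t(\cdot|x,\varphi)$ and unique invariant probability measure $\mu_\varphi$; similarly $q_n(\cdot|x,\varphi)$, $q_n^t$, $\bar\mu^n_\varphi$. $R>0$ and $\kappa_0\in(0,1)$ are constants such that, for all $t\ge1$, $x\in\mathsf X$, $n\ge1$, $\sup_{\varphi\in\Phi}\|p^t(\cdot|x,\varphi)-\mu_\varphi\|_{TV}\le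 R\kappa_0^t$ and $\sup_{\varphi\in\Phi}\|q_n^t(\cdot|x,\varphi)-\bar\mu^n_\varphi\|_{TV}\le R\kappa_0^t$ (such constants exist under the assumptions of the claim). **Error terms.** $I_1=2\|c\|R$, $I_2=2K_c\alpha$, $I_3=2\|c\|G_p\alpha$, $I_4=\frac{I_3}{I_1\ln(1/\kappa_0)}$ (the constants being such that these are well defined, with $I_4>0$); $I_1^l,I_2^l,I_3^l,I_4^l$ are obtained by replacing $c$ with $d_l$ (and $K_c$ with $K_l$). $\varepsilon_c(n)=(I_1I_4+I_2)(1/n)^{1/d}+\frac{I_3}{\ln(1/\kappa_0)}(1/n)^{1/d}\ln\bigl(\frac{n^{1/d}}{I_4}\bigr)$, $\varepsilon_{d_l}(n)=(I_1^lI_4^l+I_2^l)(1/n)^{1/d}+\frac{I_3^l}{\ln(1/\kappa_0)}(1/n)^{1/d}\ln\bigl(\frac{n^{1/d}}{I_4^l}\bigr)$, $\varepsilon_{\max}(n)=\max_{l}\varepsilon_{d_l}(n)$.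
   Formalization: The formal theorem adds the condition I_4 ≤ n^{1/d}, so that the logarithms in the error terms are nonnegative; without it the error terms can be negative for small n, the condition on n then holds for every κ, and the claim is false. *)

theory Defs
  imports "HOL-Probability.Probability"
begin

record ('s, 'a) cmdp =
  states :: "'s measure"
  actions :: "'a measure"
  init :: "'s measure"
  trans :: "'s \<times> 'a \<Rightarrow> 's measure"
  cost :: "'s \<times> 'a \<Rightarrow> real"
  constr :: "nat \<Rightarrow> 's \<times> 'a \<Rightarrow> real"

abbreviation sa_space :: "('s, 'a) cmdp \<Rightarrow> ('s \<times> 'a) measure" where
  "sa_space M \<equiv> states M \<Otimes>\<^sub>M actions M"

text \<open>The history at time \<open>t\<close> is a pair \<open>(\<omega>, x)\<close>: \<open>\<omega> s\<close> is the state-action pair at time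
  \<open>s < t\<close>, and \<open>x\<close> is the current state.\<close>

type_synonym ('s, 'a) policy = "nat \<Rightarrow> (nat \<Rightarrow> 's \<times> 'a) \<times> 's \<Rightarrow> 'a measure"

definition policies :: "('s, 'a) cmdp \<Rightarrow> ('s, 'a) policy set" where
  "policies M = {\<pi>. \<forall>t. \<pi> t \<in> (Pi\<^sub>M {0..<t} (\<lambda>_. sa_space M) \<Otimes>\<^sub>M states M)
                         \<rightarrow>\<^sub>M prob_algebra (actions M)}"

definition stationary_policies :: "('s, 'a) cmdp \<Rightarrow> ('s \<Rightarrow> 'a measure) set" where
  "stationary_policies M = states M \<rightarrow>\<^sub>M prob_algebra (actions M)"

definition stationary :: "('s \<Rightarrow> 'a measure) \<Rightarrow> ('s, 'a) policy" where
  "stationary \<phi> = (\<lambda>t h. \<phi> (snd h))"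

text \<open>The conditional law of \<open>(X\<^sub>t, A\<^sub>t)\<close> given the first \<open>t\<close> state-action pairs \<open>\<omega>\<close>, and the
  resulting law of the whole process (Ionescu-Tulcea) on \<open>nat \<Rightarrow> 's \<times> 'a\<close>.\<close>

definition step_law :: "('s, 'a) cmdp \<Rightarrow> ('s, 'a) policy \<Rightarrow> nat \<Rightarrow> (nat \<Rightarrow> 's \<times> 'a) \<Rightarrow> ('s \<times> 'a) measure" where
  "step_law M \<pi> t \<omega> =
     (case t of 0 \<Rightarrow> init M | Suc s \<Rightarrow> trans M (\<omega> s)) \<bind>
       (\<lambda>x. distr (\<pi> t (\<omega>, x)) (sa_space M) (\<lambda>a. (x, a)))"

definition process_law :: "('s, 'a) cmdp \<Rightarrow> ('s, 'a) policy \<Rightarrow> (nat \<Rightarrow> 's \<times> 'a) measure" where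
  "process_law M \<pi> =
     projective_family.lim UNIV (Ionescu_Tulcea.CI (step_law M \<pi>) (\<lambda>_. sa_space M)) (\<lambda>_. sa_space M)"

definition avg_cost :: "('s, 'a) cmdp \<Rightarrow> ('s \<times> 'a \<Rightarrow> real) \<Rightarrow> ('s, 'a) policy \<Rightarrow> ereal" where
  "avg_cost M f \<pi> =
     limsup (\<lambda>T. ereal (1 / real T * (\<integral>\<omega>. (\<Sum>t<T. f (\<omega> t)) \<partial>process_law M \<pi>)))"

text \<open>The constrained problem with constraint indices \<open>1, \<dots>, q\<close> and bounds \<open>m\<close>.\<close>

definition feasible :: "('s, 'a) cmdp \<Rightarrow> nat \<Rightarrow> (nat \<Rightarrow> real) \<Rightarrow> ('s, 'a) policy \<Rightarrow> bool" where
  "feasible M q m \<pi> \<longleftrightarrow>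
     \<pi> \<in> policies M \<and> (\<forall>l\<in>{1..q}. avg_cost M (constr M l) \<pi> \<le> ereal (m l))"

definition opt_value :: "('s, 'a) cmdp \<Rightarrow> nat \<Rightarrow> (nat \<Rightarrow> real) \<Rightarrow> ereal" where
  "opt_value M q m = (INF \<pi>\<in>{\<pi>. feasible M q m \<pi>}. avg_cost M (cost M) \<pi>)"

definition optimal :: "('s, 'a) cmdp \<Rightarrow> nat \<Rightarrow> (nat \<Rightarrow> real) \<Rightarrow> ('s, 'a) policy \<Rightarrow> bool" where
  "optimal M q m \<pi> \<longleftrightarrow>
     feasible M q m \<pi> \<and>
     (\<forall>\<pi>'. feasible M q m \<pi>' \<longrightarrow> avg_cost M (cost M) \<pi> \<le> avg_cost M (cost M) \<pi>')"

definition sup_norm_on :: "'z set \<Rightarrow> ('z \<Rightarrow> real) \<Rightarrow> real" where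
  "sup_norm_on Z f = (SUP z\<in>Z. \<bar>f z\<bar>)"

text \<open>The norm of the signed measure \<open>\<mu> - \<mu>'\<close>, for finite \<open>\<mu>\<close>, \<open>\<mu>'\<close> on the same space; test
  functions are bounded by 1, so that two probability measures are at distance at most 2.\<close>

definition tv_dist :: "'s measure \<Rightarrow> 's measure \<Rightarrow> real" where
  "tv_dist \<mu> \<mu>' =
     (SUP g\<in>{g \<in> borel_measurable \<mu>. \<forall>x\<in>space \<mu>. \<bar>g x\<bar> \<le> 1}. \<bar>(\<integral>x. g x \<partial>\<mu>) - (\<integral>x. g x \<partial>\<mu>')\<bar>)"

definition closed_loop :: "('s, 'a) cmdp \<Rightarrow> ('s \<Rightarrow> 'a measure) \<Rightarrow> 's \<Rightarrow> 's measure" where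
  "closed_loop M \<phi> x = \<phi> x \<bind> (\<lambda>a. trans M (x, a))"

primrec kernel_pow :: "'s measure \<Rightarrow> ('s \<Rightarrow> 's measure) \<Rightarrow> nat \<Rightarrow> 's \<Rightarrow> 's measure" where
  "kernel_pow S N 0 x = return S x"
| "kernel_pow S N (Suc t) x = kernel_pow S N t x \<bind> N"

definition invariant_prob :: "'s measure \<Rightarrow> ('s \<Rightarrow> 's measure) \<Rightarrow> 's measure \<Rightarrow> bool" where
  "invariant_prob S N \<mu> \<longleftrightarrow> \<mu> \<in> space (prob_algebra S) \<and> \<mu> \<bind> N = \<mu>"

definition inv_measure :: "'s measure \<Rightarrow> ('s \<Rightarrow> 's measure) \<Rightarrow> 's measure" where
  "inv_measure S N = (THE \<mu>. invariant_prob S N \<mu>)"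

definition uniformly_ergodic :: "('s, 'a) cmdp \<Rightarrow> real \<Rightarrow> real \<Rightarrow> bool" where
  "uniformly_ergodic M R \<kappa>0 \<longleftrightarrow>
     (\<forall>\<phi>\<in>stationary_policies M.
        (\<exists>!\<mu>. invariant_prob (states M) (closed_loop M \<phi>) \<mu>) \<and>
        (\<forall>t\<ge>1. \<forall>x\<in>space (states M).
           tv_dist (kernel_pow (states M) (closed_loop M \<phi>) t x)
                   (inv_measure (states M) (closed_loop M \<phi>)) \<le> R * \<kappa>0 ^ t))"

definition tv_continuous_on :: "('s::topological_space \<times> 'a::topological_space) set
    \<Rightarrow> ('s \<times> 'a \<Rightarrow> 's measure) \<Rightarrow> bool" where
  "tv_continuous_on Z p \<longleftrightarrow> (\<forall>z\<in>Z. ((\<lambda>w. tv_dist (p w) (p z)) \<longlongrightarrow> 0) (at z within Z))"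

definition minorized :: "'s measure \<Rightarrow> 'a measure \<Rightarrow> ('s \<times> 'a \<Rightarrow> 's measure) \<Rightarrow> bool" where
  "minorized S A p \<longleftrightarrow>
     (\<exists>\<eta> \<alpha>0 \<phi>. \<eta> \<in> space (prob_algebra S) \<and> \<alpha>0 \<in> {0<..<1} \<and>
        \<phi> \<in> borel_measurable (S \<Otimes>\<^sub>M A) \<and> (\<exists>B. \<forall>z\<in>space (S \<Otimes>\<^sub>M A). \<bar>\<phi> z\<bar> \<le> B) \<and>
        (\<forall>z\<in>space (S \<Otimes>\<^sub>M A). 1 - \<alpha>0 \<le> \<phi> z \<and>
           (\<forall>D\<in>sets S. measure (p z) D \<ge> measure \<eta> D * \<phi> z)))"

text \<open>The original model, the finite model on a grid \<open>Y\<close> with quantizer \<open>Q\<close>, and its extension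
  back to \<open>X\<close>. Cells are indexed by grid points rather than by the position of the point in an
  enumeration of \<open>Y\<close>. Normalizing \<open>\<nu>\<close> on a cell is expressed by \<^const>\<open>uniform_measure\<close>.\<close>

definition original_model ::
  "'s::topological_space set \<Rightarrow> 'a::topological_space set \<Rightarrow> 's measure \<Rightarrow> ('s \<times> 'a \<Rightarrow> 's measure)
    \<Rightarrow> ('s \<times> 'a \<Rightarrow> real) \<Rightarrow> (nat \<Rightarrow> 's \<times> 'a \<Rightarrow> real) \<Rightarrow> ('s, 'a) cmdp" where
  "original_model X A \<gamma> p c d =
     \<lparr> states = restrict_space borel X, actions = restrict_space borel A, init = \<gamma>,
       trans = p, cost = c, constr = d \<rparr>"

definition quantizer :: "'s::metric_space set \<Rightarrow> 's set \<Rightarrow> ('s \<Rightarrow> 's) \<Rightarrow> bool" where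
  "quantizer X Y Q \<longleftrightarrow>
     Q \<in> restrict_space borel X \<rightarrow>\<^sub>M count_space Y \<and> (\<forall>x\<in>X. \<forall>y\<in>Y. dist x (Q x) \<le> dist x y)"

definition cell :: "'s set \<Rightarrow> ('s \<Rightarrow> 's) \<Rightarrow> 's \<Rightarrow> 's set" where
  "cell X Q y = {x\<in>X. Q x = y}"

definition cell_measure :: "'s set \<Rightarrow> ('s \<Rightarrow> 's) \<Rightarrow> 's measure \<Rightarrow> 's \<Rightarrow> 's measure" where
  "cell_measure X Q \<nu> y = uniform_measure \<nu> (cell X Q y)"

definition finite_model ::
  "'s set \<Rightarrow> ('s \<Rightarrow> 's) \<Rightarrow> 's measure \<Rightarrow> 's set \<Rightarrow> 'a::topological_space set
    \<Rightarrow> 's measure \<Rightarrow> ('s \<times> 'a \<Rightarrow> 's measure)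
    \<Rightarrow> ('s \<times> 'a \<Rightarrow> real) \<Rightarrow> (nat \<Rightarrow> 's \<times> 'a \<Rightarrow> real) \<Rightarrow> ('s, 'a) cmdp" where
  "finite_model Y Q \<nu> X A \<gamma> p c d =
     \<lparr> states = count_space Y, actions = restrict_space borel A,
       init = distr \<gamma> (count_space Y) Q,
       trans = (\<lambda>(x, a). point_measure Y
         (\<lambda>y. ennreal (\<integral>z. measure (p (z, a)) (cell X Q y) \<partial>cell_measure X Q \<nu> x))),
       cost = (\<lambda>(x, a). \<integral>z. c (z, a) \<partial>cell_measure X Q \<nu> x),
       constr = (\<lambda>l (x, a). \<integral>z. d l (z, a) \<partial>cell_measure X Q \<nu> x) \<rparr>"

definition extended_model ::
  "('s \<Rightarrow> 's) \<Rightarrow> 's measure \<Rightarrow> 's::topological_space set \<Rightarrow> 'a::topological_space set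
    \<Rightarrow> 's measure \<Rightarrow> ('s \<times> 'a \<Rightarrow> 's measure)
    \<Rightarrow> ('s \<times> 'a \<Rightarrow> real) \<Rightarrow> (nat \<Rightarrow> 's \<times> 'a \<Rightarrow> real) \<Rightarrow> ('s, 'a) cmdp" where
  "extended_model Q \<nu> X A \<gamma> p c d =
     \<lparr> states = restrict_space borel X, actions = restrict_space borel A, init = \<gamma>,
       trans = (\<lambda>(x, a). cell_measure X Q \<nu> (Q x) \<bind> (\<lambda>z. p (z, a))),
       cost = (\<lambda>(x, a). \<integral>z. c (z, a) \<partial>cell_measure X Q \<nu> (Q x)),
       constr = (\<lambda>l (x, a). \<integral>z. d l (z, a) \<partial>cell_measure X Q \<nu> (Q x)) \<rparr>"

text \<open>Error terms for a cost function of sup norm \<open>C\<close> and Lipschitz constant \<open>L\<close> in state space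
  dimension \<open>N\<close>. For every number \<open>t \<ge> 1\<close> of transitions, the average costs of a stationary policy
  in the original and the extended model differ by at most
  \<open>I\<^sub>1 \<kappa>\<^sub>0\<^sup>t + (I\<^sub>2 + I\<^sub>3 t) \<delta>\<close> with \<open>\<delta> = (1/n) powr (1/N)\<close>. \<open>err_eps\<close> is the value of this expression
  at its minimizer \<open>t = ln (n powr (1/N) / I\<^sub>4) / ln (1/\<kappa>\<^sub>0)\<close> over the reals. It has no meaning as an
  error bound, and can be negative, when that minimizer is negative, i.e. when
  \<open>n powr (1/N) < I\<^sub>4\<close>.\<close>

definition err_I1 :: "real \<Rightarrow> real \<Rightarrow> real" where
  "err_I1 C R = 2 * C * R"

definition err_I2 :: "real \<Rightarrow> real \<Rightarrow> real" where
  "err_I2 L \<alpha> = 2 * L * \<alpha>"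

definition err_I3 :: "real \<Rightarrow> real \<Rightarrow> real \<Rightarrow> real" where
  "err_I3 C G \<alpha> = 2 * C * G * \<alpha>"

definition err_I4 :: "real \<Rightarrow> real \<Rightarrow> real \<Rightarrow> real \<Rightarrow> real \<Rightarrow> real" where
  "err_I4 R \<kappa>0 G \<alpha> C = err_I3 C G \<alpha> / (err_I1 C R * ln (1 / \<kappa>0))"

definition err_eps :: "real \<Rightarrow> real \<Rightarrow> real \<Rightarrow> real \<Rightarrow> nat \<Rightarrow> real \<Rightarrow> real \<Rightarrow> nat \<Rightarrow> real" where
  "err_eps R \<kappa>0 G \<alpha> N C L n =
     (err_I1 C R * err_I4 R \<kappa>0 G \<alpha> C + err_I2 L \<alpha>) * (1 / real n) powr (1 / real N)
     + err_I3 C G \<alpha> / ln (1 / \<kappa>0) * (1 / real n) powr (1 / real N)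
         * ln (real n powr (1 / real N) / err_I4 R \<kappa>0 G \<alpha> C)"

end

theory Submission
  imports Defs
begin

text \<open>
  The average cost of a stationary policy is the integral of the cost against the invariant law of the
  closed loop. Everything rests on one estimate for such laws, \<open>tv_dist_near_invariant\<close>: if one step of a
  uniformly ergodic kernel moves \<open>\<mu>\<close> by at most \<open>D\<close> in total variation, then \<open>\<mu>\<close> is within
  \<open>t * D + R * \<kappa>0 ^ t\<close> of the invariant law, for every \<open>t \<ge> 1\<close>.

  Applied to the invariant law of the extended model, the estimate compares the two models
  (\<open>stationary_cost_perturbation\<close>): \<open>D\<close> is the distance of the transition laws, bounded by \<open>\<Delta>\<close>, the
  Lipschitz constant times the bound on the cell diameter. For a cost bounded by \<open>C\<close>, the error term of the theorem consists of
  the oscillation of the cost on a cell and of the minimum of \<open>C * (t * \<Delta> + 2 * R * \<kappa>0 ^ t)\<close> over real \<open>t\<close>,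
  while the number \<open>t\<close> of steps in the estimate is an integer. The gap is closed by two observations. Costs are
  nonnegative, so they can be centred, which saves a factor two; and \<open>D\<close> never exceeds \<open>2 * R * \<kappa>0\<close>,
  because all transition laws under one fixed action are close to a common invariant law. Together
  with \<open>ceiling_trade_off\<close> this gives exactly the stated error term, as long as the real minimizer is
  nonnegative.

  The optimal value of the original problem is an infimum over history-dependent policies. The
  occupation measure of any policy up to time \<open>T\<close> has a state marginal that is nearly invariant for the
  policy obtained by conditioning the action on the cell of the state in a grid; the defect vanishes as
  \<open>T\<close> grows and the grid is refined.
  By the same estimate this stationary policy has almost the same costs
  (\<open>stationary_dominates_mixture\<close>).

  Finally, let \<open>\<pi>\<close> be feasible for the original problem. Mixing its occupation measures with those of the
  strictly feasible policy and making the result stationary gives a policy that satisfies all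
  constraints with a margin. The margin covers the tightening \<open>\<epsilon>\<close> and the error of the constraints, so the
  new policy competes with the given optimal one in the extended model. The mixing weight is about
  \<open>(\<epsilon> + \<epsilon>\<^sub>m\<^sub>a\<^sub>x) / min \<alpha>'\<close>, and with the given constant \<open>K\<close> the mixing and the two changes of model together
  cost less than \<open>\<kappa>\<close> (\<open>near_optimal_of_stationary_approximation\<close>).
\<close>

section \<open>Bounded functions and probability kernels\<close>

text \<open>Costs and test functions are all bounded. Carrying the bound together with measurability makes
  integrability against every probability measure automatic, and integration against a probability
  kernel preserves it.\<close>

definition bounded_meas :: "'z measure \<Rightarrow> real \<Rightarrow> ('z \<Rightarrow> real) set" where
  "bounded_meas S B = {f \<in> borel_measurable S. \<forall>x\<in>space S. \<bar>f x\<bar> \<le> B}"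

lemma bounded_measI: "f \<in> borel_measurable S \<Longrightarrow> (\<And>x. x \<in> space S \<Longrightarrow> \<bar>f x\<bar> \<le> B) \<Longrightarrow> f \<in> bounded_meas S B"
  by (simp add: bounded_meas_def)

lemma bounded_measD:
  assumes "f \<in> bounded_meas S B"
  shows "f \<in> borel_measurable S" "x \<in> space S \<Longrightarrow> \<bar>f x\<bar> \<le> B"
  using assms by (auto simp: bounded_meas_def)

lemma prob_algebraD:
  assumes "\<mu> \<in> space (prob_algebra S)"
  shows "sets \<mu> = sets S" "space \<mu> = space S" "prob_space \<mu>" "\<mu> \<in> space (subprob_algebra S)"
    "space S \<noteq> {}"
proof -
  show *: "sets \<mu> = sets S" "prob_space \<mu>"
    using assms by (auto simp: space_prob_algebra)
  show **: "space \<mu> = space S"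
    using sets_eq_imp_space_eq[OF *(1)] .
  show "\<mu> \<in> space (subprob_algebra S)"
    using * by (simp add: space_subprob_algebra prob_space_imp_subprob_space)
  show "space S \<noteq> {}"
    using prob_space.not_empty[OF *(2)] ** by simp
qed

lemma bounded_meas_nonneg:
  assumes "\<mu> \<in> space (prob_algebra S)" "f \<in> bounded_meas S B"
  shows "0 \<le> B"
  using prob_algebraD(5)[OF assms(1)] bounded_measD(2)[OF assms(2)] by fastforce

lemma bounded_meas_integrable:
  assumes "\<mu> \<in> space (prob_algebra S)" "f \<in> bounded_meas S B"
  shows "integrable \<mu> f"
proof -
  interpret prob_space \<mu> by (rule prob_algebraD(3)[OF assms(1)])
  show ?thesis
    using assms prob_algebraD[OF assms(1)]
    by (intro integrable_const_bound[where B=B])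
       (auto simp: bounded_meas_def cong: measurable_cong_sets)
qed

lemma bounded_meas_integral_le:
  assumes \<mu>: "\<mu> \<in> space (prob_algebra S)" and f: "f \<in> bounded_meas S B"
  shows "\<bar>\<integral>x. f x \<partial>\<mu>\<bar> \<le> B"
proof -
  interpret prob_space \<mu> by (rule prob_algebraD(3)[OF \<mu>])
  have "\<bar>\<integral>x. f x \<partial>\<mu>\<bar> \<le> (\<integral>x. \<bar>f x\<bar> \<partial>\<mu>)"
    by (rule integral_abs_bound)
  also have "\<dots> \<le> (\<integral>x. B \<partial>\<mu>)"
    using f prob_algebraD(2)[OF \<mu>] bounded_meas_integrable[OF \<mu> f]
    by (intro integral_mono) (auto simp: bounded_meas_def)
  finally show ?thesis by (simp add: prob_space)
qed

lemma integral_diff_le: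
  assumes \<mu>: "\<mu> \<in> space (prob_algebra S)" and f: "f \<in> bounded_meas S B" and g: "g \<in> bounded_meas S B'"
    and fg: "\<And>x. x \<in> space S \<Longrightarrow> \<bar>f x - g x\<bar> \<le> D"
  shows "\<bar>(\<integral>x. f x \<partial>\<mu>) - (\<integral>x. g x \<partial>\<mu>)\<bar> \<le> D"
proof -
  have "(\<integral>x. f x \<partial>\<mu>) - (\<integral>x. g x \<partial>\<mu>) = (\<integral>x. f x - g x \<partial>\<mu>)"
    using bounded_meas_integrable[OF \<mu>] f g by (intro Bochner_Integration.integral_diff[symmetric]) auto
  also have "\<bar>\<dots>\<bar> \<le> D"
    using f g fg by (intro bounded_meas_integral_le[OF \<mu>]) (auto simp: bounded_meas_def)
  finally show ?thesis .
qed

lemma bounded_meas_kernel_integral: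
  assumes N: "N \<in> S \<rightarrow>\<^sub>M prob_algebra L" and f: "f \<in> bounded_meas L B"
  shows "(\<lambda>x. \<integral>y. f y \<partial>N x) \<in> bounded_meas S B"
proof (rule bounded_measI)
  show "(\<lambda>x. \<integral>y. f y \<partial>N x) \<in> borel_measurable S"
    using measurable_compose[OF measurable_prob_algebraD[OF N]
        integral_measurable_subprob_algebra[OF bounded_measD(1)[OF f]]] .
  show "\<bar>\<integral>y. f y \<partial>N x\<bar> \<le> B" if "x \<in> space S" for x
    using bounded_meas_integral_le[OF measurable_space[OF N that] f] .
qed

lemma integral_bind_kernel:
  assumes \<mu>: "\<mu> \<in> space (prob_algebra S)" and N: "N \<in> S \<rightarrow>\<^sub>M prob_algebra L" and f: "f \<in> bounded_meas L B"
  shows "(\<integral>y. f y \<partial>(\<mu> \<bind> N)) = (\<integral>x. \<integral>y. f y \<partial>N x \<partial>\<mu>)"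
proof -
  interpret prob_space \<mu> by (rule prob_algebraD(3)[OF \<mu>])
  have "N \<in> \<mu> \<rightarrow>\<^sub>M subprob_algebra L"
    using measurable_prob_algebraD[OF N] prob_algebraD(1)[OF \<mu>] by (simp cong: measurable_cong_sets)
  then show ?thesis
    using f by (intro integral_bind[where K=L and B=B and B'=1])
      (auto simp: bounded_meas_def not_empty finite_measure_axioms
        dest!: measurable_space[where f=N] intro!: AE_I2 subprob_space.emeasure_space_le_1 
         simp: space_subprob_algebra)
qed

lemma bind_in_prob_algebra:
  assumes "\<mu> \<in> space (prob_algebra S)" "N \<in> S \<rightarrow>\<^sub>M prob_algebra L"
  shows "\<mu> \<bind> N \<in> space (prob_algebra L)"
  using assms by (simp add: space_prob_algebra[of L] prob_space_bind' sets_bind')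

lemma integral_pair_kernel:
  assumes N: "N \<in> S \<rightarrow>\<^sub>M prob_algebra L" and f: "f \<in> bounded_meas (S \<Otimes>\<^sub>M L) B"
  shows "(\<lambda>x. \<integral>y. f (x, y) \<partial>N x) \<in> bounded_meas S B"
    and "x \<in> space S \<Longrightarrow> (\<lambda>y. f (x, y)) \<in> bounded_meas L B"
    and "x \<in> space S \<Longrightarrow> (\<integral>z. f z \<partial>distr (N x) (S \<Otimes>\<^sub>M L) (\<lambda>y. (x, y))) = (\<integral>y. f (x, y) \<partial>N x)"
    and "(\<lambda>x. distr (N x) (S \<Otimes>\<^sub>M L) (\<lambda>y. (x, y))) \<in> S \<rightarrow>\<^sub>M prob_algebra (S \<Otimes>\<^sub>M L)"
proof -
  note N[measurable]
  show 4: "(\<lambda>x. distr (N x) (S \<Otimes>\<^sub>M L) (\<lambda>y. (x, y))) \<in> S \<rightarrow>\<^sub>M prob_algebra (S \<Otimes>\<^sub>M L)"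
    by measurable
  show 3: "(\<integral>z. f z \<partial>distr (N x) (S \<Otimes>\<^sub>M L) (\<lambda>y. (x, y))) = (\<integral>y. f (x, y) \<partial>N x)"
    if x: "x \<in> space S" for x
    using bounded_measD(1)[OF f] x prob_algebraD(1)[OF measurable_space[OF N x]]
    by (intro integral_distr) (auto cong: measurable_cong_sets)
  have "(\<lambda>x. \<integral>y. f (x, y) \<partial>N x) \<in> borel_measurable S"
    using bounded_measD(1)[OF bounded_meas_kernel_integral[OF 4 f]]
    by (subst measurable_cong[OF 3[symmetric]])
  then show "(\<lambda>x. \<integral>y. f (x, y) \<partial>N x) \<in> bounded_meas S B"
    using bounded_measD(2)[OF bounded_meas_kernel_integral[OF 4 f]] 3
    by (auto intro!: bounded_measI)
  show "x \<in> space S \<Longrightarrow> (\<lambda>y. f (x, y)) \<in> bounded_meas L B"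
    using f by (auto simp: bounded_meas_def space_pair_measure)
qed

section \<open>Total variation and nearly invariant measures\<close>

lemma tv_dist_ge:
  assumes \<mu>: "\<mu> \<in> space (prob_algebra S)" and \<mu>': "\<mu>' \<in> space (prob_algebra S)" and f: "f \<in> bounded_meas S 1"
  shows "\<bar>(\<integral>x. f x \<partial>\<mu>) - (\<integral>x. f x \<partial>\<mu>')\<bar> \<le> tv_dist \<mu> \<mu>'"
proof -
  have eq: "{g \<in> borel_measurable \<mu>. \<forall>x\<in>space \<mu>. \<bar>g x\<bar> \<le> 1} = bounded_meas S 1"
    using prob_algebraD(1,2)[OF \<mu>] by (simp add: bounded_meas_def cong: measurable_cong_sets)
  show ?thesis
    unfolding tv_dist_def eq
  proof (rule cSUP_upper[OF f], rule bdd_aboveI2[where M=2])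
    fix g assume "g \<in> bounded_meas S 1"
    with bounded_meas_integral_le[OF \<mu> this] bounded_meas_integral_le[OF \<mu>' this]
    show "\<bar>(\<integral>x. g x \<partial>\<mu>) - (\<integral>x. g x \<partial>\<mu>')\<bar> \<le> 2" by linarith
  qed
qed

lemma tv_dist_le:
  assumes \<mu>: "\<mu> \<in> space (prob_algebra S)"
    and "\<And>f. f \<in> bounded_meas S 1 \<Longrightarrow> \<bar>(\<integral>x. f x \<partial>\<mu>) - (\<integral>x. f x \<partial>\<mu>')\<bar> \<le> D"
  shows "tv_dist \<mu> \<mu>' \<le> D"
proof -
  have eq: "{g \<in> borel_measurable \<mu>. \<forall>x\<in>space \<mu>. \<bar>g x\<bar> \<le> 1} = bounded_meas S 1"
    using prob_algebraD(1,2)[OF \<mu>] by (simp add: bounded_meas_def cong: measurable_cong_sets)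
  have "(\<lambda>_. 0) \<in> bounded_meas S 1"
    by (simp add: bounded_meas_def)
  then show ?thesis
    unfolding tv_dist_def eq using assms(2) by (intro cSUP_least) auto
qed

lemma tv_dist_ge_scaled:
  assumes \<mu>: "\<mu> \<in> space (prob_algebra S)" and \<mu>': "\<mu>' \<in> space (prob_algebra S)" and f: "f \<in> bounded_meas S C"
  shows "\<bar>(\<integral>x. f x \<partial>\<mu>) - (\<integral>x. f x \<partial>\<mu>')\<bar> \<le> C * tv_dist \<mu> \<mu>'"
proof (cases "C = 0")
  case True
  then show ?thesis
    using bounded_meas_integral_le[OF \<mu> f] bounded_meas_integral_le[OF \<mu>' f] by simp
next
  case False
  then have C: "C > 0" using bounded_meas_nonneg[OF \<mu> f] by simp
  have "(\<lambda>x. f x / C) \<in> bounded_meas S 1"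
    using f C by (auto simp: bounded_meas_def divide_le_eq)
  from tv_dist_ge[OF \<mu> \<mu>' this] C show ?thesis
    by (simp add: diff_divide_distrib[symmetric] divide_le_eq mult.commute)
qed

text \<open>Subtracting \<open>C / 2\<close> centres \<open>f\<close> and so halves the constant of the previous estimate. This factor
  two later pays for rounding a real number of transitions to an integer.\<close>

lemma tv_dist_ge_range:
  assumes \<mu>: "\<mu> \<in> space (prob_algebra S)" and \<mu>': "\<mu>' \<in> space (prob_algebra S)"
    and f: "f \<in> borel_measurable S" "\<And>x. x \<in> space S \<Longrightarrow> 0 \<le> f x" "\<And>x. x \<in> space S \<Longrightarrow> f x \<le> C"
  shows "\<bar>(\<integral>x. f x \<partial>\<mu>) - (\<integral>x. f x \<partial>\<mu>')\<bar> \<le> C / 2 * tv_dist \<mu> \<mu>'"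
proof -
  have "(\<lambda>x. f x - C / 2) \<in> bounded_meas S (C / 2)"
  proof (rule bounded_measI)
    show "\<bar>f x - C / 2\<bar> \<le> C / 2" if "x \<in> space S" for x
      using f(2,3)[OF that] by (simp add: abs_le_iff field_simps)
  qed (use f(1) in measurable)
  from tv_dist_ge_scaled[OF \<mu> \<mu>' this]
  have *: "\<bar>(\<integral>x. f x - C / 2 \<partial>\<mu>) - (\<integral>x. f x - C / 2 \<partial>\<mu>')\<bar> \<le> C / 2 * tv_dist \<mu> \<mu>'" .
  have fb: "f \<in> bounded_meas S C"
    using f by (auto intro!: bounded_measI)
  have "(\<integral>x. f x - C / 2 \<partial>m) = (\<integral>x. f x \<partial>m) - C / 2" if m: "m \<in> space (prob_algebra S)" for m
  proof -
    interpret prob_space m by (rule prob_algebraD(3)[OF m])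
    show ?thesis
      using bounded_meas_integrable[OF m fb] by (simp add: prob_space)
  qed
  with * \<mu> \<mu>' show ?thesis by simp
qed

lemma tv_dist_commute:
  assumes "\<mu> \<in> space (prob_algebra S)" "\<mu>' \<in> space (prob_algebra S)"
  shows "tv_dist \<mu> \<mu>' = tv_dist \<mu>' \<mu>"
proof (rule antisym)
  show "tv_dist \<mu> \<mu>' \<le> tv_dist \<mu>' \<mu>"
    by (rule tv_dist_le[OF assms(1)]) (subst abs_minus_commute, rule tv_dist_ge[OF assms(2,1)])
  show "tv_dist \<mu>' \<mu> \<le> tv_dist \<mu> \<mu>'"
    by (rule tv_dist_le[OF assms(2)]) (subst abs_minus_commute, rule tv_dist_ge[OF assms(1,2)])
qed

lemma tv_dist_triangle:
  assumes "\<mu>1 \<in> space (prob_algebra S)" "\<mu>2 \<in> space (prob_algebra S)" "\<mu>3 \<in> space (prob_algebra S)"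
  shows "tv_dist \<mu>1 \<mu>3 \<le> tv_dist \<mu>1 \<mu>2 + tv_dist \<mu>2 \<mu>3"
proof (rule tv_dist_le[OF assms(1)])
  fix f assume f: "f \<in> bounded_meas S 1"
  show "\<bar>(\<integral>x. f x \<partial>\<mu>1) - (\<integral>x. f x \<partial>\<mu>3)\<bar> \<le> tv_dist \<mu>1 \<mu>2 + tv_dist \<mu>2 \<mu>3"
    using tv_dist_ge[OF assms(1,2) f] tv_dist_ge[OF assms(2,3) f] by linarith
qed

lemma tv_dist_bind_contract:
  assumes \<mu>: "\<mu> \<in> space (prob_algebra S)" and \<mu>': "\<mu>' \<in> space (prob_algebra S)"
    and N: "N \<in> S \<rightarrow>\<^sub>M prob_algebra L"
  shows "tv_dist (\<mu> \<bind> N) (\<mu>' \<bind> N) \<le> tv_dist \<mu> \<mu>'"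
proof (rule tv_dist_le[OF bind_in_prob_algebra[OF \<mu> N]])
  fix f assume f: "f \<in> bounded_meas L 1"
  show "\<bar>(\<integral>x. f x \<partial>(\<mu> \<bind> N)) - (\<integral>x. f x \<partial>(\<mu>' \<bind> N))\<bar> \<le> tv_dist \<mu> \<mu>'"
    using tv_dist_ge[OF \<mu> \<mu>' bounded_meas_kernel_integral[OF N f]]
    by (simp add: integral_bind_kernel[OF \<mu> N f] integral_bind_kernel[OF \<mu>' N f])
qed

lemma tv_dist_bind_kernels:
  assumes \<mu>: "\<mu> \<in> space (prob_algebra S)"
    and N: "N \<in> S \<rightarrow>\<^sub>M prob_algebra L" and N': "N' \<in> S \<rightarrow>\<^sub>M prob_algebra L"
    and D: "\<And>x. x \<in> space S \<Longrightarrow> tv_dist (N x) (N' x) \<le> D"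
  shows "tv_dist (\<mu> \<bind> N) (\<mu> \<bind> N') \<le> D"
proof (rule tv_dist_le[OF bind_in_prob_algebra[OF \<mu> N]])
  fix f assume f: "f \<in> bounded_meas L 1"
  have "\<bar>(\<integral>x. \<integral>y. f y \<partial>N x \<partial>\<mu>) - (\<integral>x. \<integral>y. f y \<partial>N' x \<partial>\<mu>)\<bar> \<le> D"
    using tv_dist_ge[OF measurable_space[OF N] measurable_space[OF N'] f] D
    by (intro integral_diff_le[OF \<mu> bounded_meas_kernel_integral[OF N f] bounded_meas_kernel_integral[OF N' f]])
       (meson order_trans)
  then show "\<bar>(\<integral>x. f x \<partial>(\<mu> \<bind> N)) - (\<integral>x. f x \<partial>(\<mu> \<bind> N'))\<bar> \<le> D"
    by (simp add: integral_bind_kernel[OF \<mu> N f] integral_bind_kernel[OF \<mu> N' f])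
qed

lemma tv_dist_bind_const:
  assumes \<mu>: "\<mu> \<in> space (prob_algebra S)"
    and N: "N \<in> S \<rightarrow>\<^sub>M prob_algebra L" and m: "m \<in> space (prob_algebra L)"
    and D: "\<And>x. x \<in> space S \<Longrightarrow> tv_dist (N x) m \<le> D"
  shows "tv_dist (\<mu> \<bind> N) m \<le> D"
proof -
  have c: "(\<lambda>_. m) \<in> S \<rightarrow>\<^sub>M prob_algebra L" using m by simp
  have "\<mu> \<bind> (\<lambda>_. m) = m"
    by (rule bind_const'[OF prob_algebraD(3)[OF \<mu>] prob_space_imp_subprob_space[OF prob_algebraD(3)[OF m]]])
  with tv_dist_bind_kernels[OF \<mu> N c] D show ?thesis by metis
qed

lemma bind_assoc_prob:
  assumes "\<mu> \<in> space (prob_algebra S)" "N \<in> S \<rightarrow>\<^sub>M prob_algebra L" "N' \<in> L \<rightarrow>\<^sub>M prob_algebra K"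
  shows "(\<mu> \<bind> N) \<bind> N' = \<mu> \<bind> (\<lambda>x. N x \<bind> N')"
proof (rule bind_assoc)
  show "N \<in> \<mu> \<rightarrow>\<^sub>M subprob_algebra L"
    using measurable_prob_algebraD[OF assms(2)] prob_algebraD(1)[OF assms(1)]
    by (simp cong: measurable_cong_sets)
qed (rule measurable_prob_algebraD[OF assms(3)])

lemma kernel_pow_measurable:
  assumes N[measurable]: "N \<in> S \<rightarrow>\<^sub>M prob_algebra S"
  shows "kernel_pow S N t \<in> S \<rightarrow>\<^sub>M prob_algebra S"
proof (induction t)
  case 0
  have "kernel_pow S N 0 = return S" by auto
  then show ?case by simp
next
  case (Suc t)
  have "kernel_pow S N (Suc t) = (\<lambda>x. kernel_pow S N t x \<bind> N)" by auto
  with measurable_bind_prob_space[OF Suc N] show ?case by simp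
qed

lemma tv_dist_kernel_pow_near_invariant:
  assumes \<mu>: "\<mu> \<in> space (prob_algebra S)" and N: "N \<in> S \<rightarrow>\<^sub>M prob_algebra S"
    and D: "tv_dist (\<mu> \<bind> N) \<mu> \<le> D"
  shows "tv_dist (\<mu> \<bind> kernel_pow S N t) \<mu> \<le> real t * D"
proof (induction t)
  case 0
  have "kernel_pow S N 0 = return S" by auto
  then have "\<mu> \<bind> kernel_pow S N 0 = \<mu>"
    using bind_return'' prob_algebraD(1)[OF \<mu>] by simp
  moreover have "tv_dist \<mu> \<mu> \<le> 0" by (rule tv_dist_le[OF \<mu>]) simp
  ultimately show ?case by (simp del: kernel_pow.simps)
next
  case (Suc t)
  note P = kernel_pow_measurable[OF N]
  have "kernel_pow S N (Suc t) = (\<lambda>x. kernel_pow S N t x \<bind> N)" by auto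
  then have eq: "\<mu> \<bind> kernel_pow S N (Suc t) = (\<mu> \<bind> kernel_pow S N t) \<bind> N"
    using bind_assoc_prob[OF \<mu> P N] by simp
  have "tv_dist (\<mu> \<bind> kernel_pow S N (Suc t)) \<mu>
      \<le> tv_dist ((\<mu> \<bind> kernel_pow S N t) \<bind> N) (\<mu> \<bind> N) + tv_dist (\<mu> \<bind> N) \<mu>"
    unfolding eq by (intro tv_dist_triangle[where S=S] bind_in_prob_algebra[where S=S] \<mu> N P)
  also have "tv_dist ((\<mu> \<bind> kernel_pow S N t) \<bind> N) (\<mu> \<bind> N) \<le> real t * D"
    using tv_dist_bind_contract[OF bind_in_prob_algebra[OF \<mu> P] \<mu> N] Suc by (rule order_trans)
  finally show ?case using D by (simp add: algebra_simps del: kernel_pow.simps)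
qed

text \<open>Since \<open>bind\<close> contracts, \<open>t\<close> steps of the kernel move \<open>\<mu>\<close> by at most \<open>t\<close> times its one-step defect \<open>D\<close>;
  ergodicity says that the same \<open>t\<close> steps bring every law within \<open>B\<close> of \<open>m\<close>. The estimate serves
  twice: for time averages of a process, where \<open>D\<close> is of order \<open>1 / T\<close> up to a discretization error, and
  for the invariant law of a perturbed kernel, where \<open>D\<close> is the size of the perturbation.\<close>

lemma tv_dist_near_invariant:
  assumes \<mu>: "\<mu> \<in> space (prob_algebra S)" and N: "N \<in> S \<rightarrow>\<^sub>M prob_algebra S"
    and m: "m \<in> space (prob_algebra S)"
    and D: "tv_dist (\<mu> \<bind> N) \<mu> \<le> D"
    and B: "\<And>x. x \<in> space S \<Longrightarrow> tv_dist (kernel_pow S N t x) m \<le> B"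
  shows "tv_dist \<mu> m \<le> real t * D + B"
proof -
  note P = kernel_pow_measurable[OF N, of t]
  note \<mu>P = bind_in_prob_algebra[OF \<mu> P]
  have "tv_dist \<mu> m \<le> tv_dist \<mu> (\<mu> \<bind> kernel_pow S N t) + tv_dist (\<mu> \<bind> kernel_pow S N t) m"
    by (rule tv_dist_triangle[OF \<mu> \<mu>P m])
  with tv_dist_kernel_pow_near_invariant[OF \<mu> N D, of t] tv_dist_bind_const[OF \<mu> P m B]
  show ?thesis by (simp add: tv_dist_commute[OF \<mu> \<mu>P])
qed

section \<open>The controlled process and its occupation measures\<close>

locale controlled_model =
  fixes M :: "('s, 'a) cmdp"
  assumes trans_kernel: "trans M \<in> sa_space M \<rightarrow>\<^sub>M prob_algebra (states M)"
    and init_prob: "init M \<in> space (prob_algebra (states M))"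
begin

text \<open>The conditional law of the state at time \<open>t\<close> given the earlier state-action pairs: the factor of
  \<^const>\<open>step_law\<close> that does not involve the policy.\<close>

definition next_state :: "nat \<Rightarrow> (nat \<Rightarrow> 's \<times> 'a) \<Rightarrow> 's measure" where
  "next_state t \<omega> = (case t of 0 \<Rightarrow> init M | Suc s \<Rightarrow> trans M (\<omega> s))"

lemma next_state_measurable:
  "next_state t \<in> Pi\<^sub>M {0..<t} (\<lambda>_. sa_space M) \<rightarrow>\<^sub>M prob_algebra (states M)"
proof (cases t)
  case 0
  then have "next_state t = (\<lambda>_. init M)" by (auto simp: next_state_def)
  then show ?thesis using init_prob by simp
next
  case (Suc s)
  then have "next_state t = (\<lambda>\<omega>. trans M (\<omega> s))" by (auto simp: next_state_def)
  moreover have "(\<lambda>\<omega>. \<omega> s) \<in> Pi\<^sub>M {0..<t} (\<lambda>_. sa_space M) \<rightarrow>\<^sub>M sa_space M"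
    by (rule measurable_component_singleton) (simp add: Suc)
  ultimately show ?thesis
    using measurable_compose[OF _ trans_kernel] by simp
qed

lemma policy_measurable:
  assumes "\<pi> \<in> policies M"
  shows "(\<lambda>(\<omega>, x). \<pi> t (\<omega>, x))
    \<in> (Pi\<^sub>M {0..<t} (\<lambda>_. sa_space M) \<Otimes>\<^sub>M states M) \<rightarrow>\<^sub>M prob_algebra (actions M)"
  using assms by (simp add: policies_def)

lemma policy_measurable_state:
  assumes "\<pi> \<in> policies M" "\<omega> \<in> space (Pi\<^sub>M {0..<t} (\<lambda>_. sa_space M))"
  shows "(\<lambda>x. \<pi> t (\<omega>, x)) \<in> states M \<rightarrow>\<^sub>M prob_algebra (actions M)"
  using measurable_compose[OF measurable_Pair1'[OF assms(2)]] assms(1) by (auto simp: policies_def)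

lemma step_law_measurable:
  assumes \<pi>: "\<pi> \<in> policies M"
  shows "step_law M \<pi> t \<in> Pi\<^sub>M {0..<t} (\<lambda>_. sa_space M) \<rightarrow>\<^sub>M prob_algebra (sa_space M)"
proof -
  note policy_measurable[OF \<pi>, measurable] next_state_measurable[measurable]
  have "step_law M \<pi> t =
      (\<lambda>\<omega>. next_state t \<omega> \<bind> (\<lambda>x. distr (\<pi> t (\<omega>, x)) (sa_space M) (\<lambda>a. (x, a))))"
    by (auto simp: step_law_def next_state_def)
  also have "\<dots> \<in> Pi\<^sub>M {0..<t} (\<lambda>_. sa_space M) \<rightarrow>\<^sub>M prob_algebra (sa_space M)"
    by measurable
  finally show ?thesis .
qed

lemma integral_step_law:
  assumes \<pi>: "\<pi> \<in> policies M" and \<omega>: "\<omega> \<in> space (Pi\<^sub>M {0..<t} (\<lambda>_. sa_space M))"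
    and f: "f \<in> bounded_meas (sa_space M) B"
  shows "(\<integral>z. f z \<partial>step_law M \<pi> t \<omega>) = (\<integral>x. \<integral>a. f (x, a) \<partial>\<pi> t (\<omega>, x) \<partial>next_state t \<omega>)"
proof -
  note N = policy_measurable_state[OF \<pi> \<omega>]
  note m = measurable_space[OF next_state_measurable \<omega>]
  have "(\<integral>z. f z \<partial>step_law M \<pi> t \<omega>) =
    (\<integral>z. f z \<partial>(next_state t \<omega> \<bind> (\<lambda>x. distr (\<pi> t (\<omega>, x)) (sa_space M) (\<lambda>a. (x, a)))))"
    by (simp add: step_law_def next_state_def)
  also have "\<dots> = (\<integral>x. \<integral>z. f z \<partial>distr (\<pi> t (\<omega>, x)) (sa_space M) (\<lambda>a. (x, a)) \<partial>next_state t \<omega>)"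
    by (rule integral_bind_kernel[OF m integral_pair_kernel(4)[OF N f] f])
  also have "\<dots> = (\<integral>x. \<integral>a. f (x, a) \<partial>\<pi> t (\<omega>, x) \<partial>next_state t \<omega>)"
    using prob_algebraD(2)[OF m] integral_pair_kernel(3)[OF N f]
    by (intro Bochner_Integration.integral_cong) auto
  finally show ?thesis .
qed

lemma Ionescu_Tulcea_step_law:
  assumes \<pi>: "\<pi> \<in> policies M"
  shows "Ionescu_Tulcea (step_law M \<pi>) (\<lambda>_. sa_space M)"
  using measurable_prob_algebraD[OF step_law_measurable[OF \<pi>]]
    prob_algebraD(3)[OF measurable_space[OF step_law_measurable[OF \<pi>]]]
  by (rule Ionescu_Tulcea.intro)

lemma process_law_sets:
  assumes \<pi>: "\<pi> \<in> policies M"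
  shows "sets (process_law M \<pi>) = sets (Pi\<^sub>M UNIV (\<lambda>_. sa_space M))"
proof -
  interpret IT: Ionescu_Tulcea "step_law M \<pi>" "\<lambda>_. sa_space M"
    by (rule Ionescu_Tulcea_step_law[OF \<pi>])
  show ?thesis by (simp add: process_law_def)
qed

text \<open>The index set \<open>{0..<t}\<close> is an initial segment, so the projective limit restricted to it is the
  \<open>t\<close>-step measure of the Ionescu-Tulcea construction itself.\<close>

lemma process_law_prefix:
  assumes \<pi>: "\<pi> \<in> policies M"
  shows "distr (process_law M \<pi>) (Pi\<^sub>M {0..<t} (\<lambda>_. sa_space M)) (\<lambda>\<omega>. restrict \<omega> {0..<t})
    = Ionescu_Tulcea.C (step_law M \<pi>) (\<lambda>_. sa_space M) 0 t (\<lambda>_. undefined)"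
proof -
  interpret IT: Ionescu_Tulcea "step_law M \<pi>" "\<lambda>_. sa_space M"
    by (rule Ionescu_Tulcea_step_law[OF \<pi>])
  have up: "IT.up_to {0..<t} = t"
    unfolding IT.up_to_def by (rule Least_equality) (auto simp: not_le[symmetric])
  show ?thesis
    unfolding process_law_def IT.distr_lim[OF finite_atLeastLessThan] IT.CI_def up
    using IT.distr_C[of t t "\<lambda>_. undefined" 0] by simp
qed

lemma process_law_prob:
  assumes \<pi>: "\<pi> \<in> policies M"
  shows "process_law M \<pi> \<in> space (prob_algebra (Pi\<^sub>M UNIV (\<lambda>_. sa_space M)))"
proof -
  interpret IT: Ionescu_Tulcea "step_law M \<pi>" "\<lambda>_. sa_space M"
    by (rule Ionescu_Tulcea_step_law[OF \<pi>])
  have "prob_space (IT.C 0 0 (\<lambda>_. undefined))"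
    by (rule IT.prob_space_C) simp
  then have "prob_space (process_law M \<pi>)"
    unfolding process_law_prefix[OF \<pi>, symmetric]
    by (rule prob_space_distrD[rotated])
      (auto simp: measurable_cong_sets[OF process_law_sets[OF \<pi>] refl] intro!: measurable_restrict_subset)
  then show ?thesis
    by (simp add: space_prob_algebra process_law_sets[OF \<pi>])
qed

text \<open>The tower property. Both sides depend only on finitely many coordinates, and on the \<open>t\<close>-step measures
  of the construction the identity is the defining recursion.\<close>

lemma integral_process_law_coordinate:
  assumes \<pi>: "\<pi> \<in> policies M" and f: "f \<in> bounded_meas (sa_space M) B"
  shows "(\<integral>\<omega>. f (\<omega> t) \<partial>process_law M \<pi>)
    = (\<integral>\<omega>. \<integral>z. f z \<partial>step_law M \<pi> t (restrict \<omega> {0..<t}) \<partial>process_law M \<pi>)"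
proof -
  let ?L = "process_law M \<pi>" and ?E = "\<lambda>t. Pi\<^sub>M {0..<t} (\<lambda>_. sa_space M)"
  interpret IT: Ionescu_Tulcea "step_law M \<pi>" "\<lambda>_. sa_space M"
    by (rule Ionescu_Tulcea_step_law[OF \<pi>])
  define C where "C t = IT.C 0 t (\<lambda>_. undefined)" for t
  have C: "C t \<in> space (prob_algebra (?E t))" for t
    unfolding C_def using IT.sets_C[of "\<lambda>_. undefined" 0 t] IT.prob_space_C[of "\<lambda>_. undefined" 0 t]
    by (simp add: space_prob_algebra)
  have res: "(\<lambda>\<omega>. restrict \<omega> {0..<t}) \<in> ?L \<rightarrow>\<^sub>M ?E t" for t
    by (auto simp: measurable_cong_sets[OF process_law_sets[OF \<pi>] refl] intro!: measurable_restrict_subset)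
  note fm[measurable] = bounded_measD(1)[OF f]
  have eP: "IT.eP t \<in> ?E t \<rightarrow>\<^sub>M prob_algebra (?E (Suc t))"
    by (rule measurable_prob_algebraI[OF IT.prob_space_eP IT.measurable_eP])
  have ft: "(\<lambda>\<omega>. f (\<omega> t)) \<in> bounded_meas (?E (Suc t)) B"
    using f by (auto simp: bounded_meas_def space_PiM PiE_iff intro!: measurable_compose[OF measurable_component_singleton])
  have "(\<integral>\<omega>. f (\<omega> t) \<partial>?L) = (\<integral>\<omega>. f (\<omega> t) \<partial>distr ?L (?E (Suc t)) (\<lambda>\<omega>. restrict \<omega> {0..<Suc t}))"
    using res[of "Suc t"] bounded_measD(1)[OF ft] by (subst integral_distr) auto
  also have "\<dots> = (\<integral>\<omega>. f (\<omega> t) \<partial>(C t \<bind> IT.eP t))"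
    unfolding process_law_prefix[OF \<pi>] C_def by simp
  also have "\<dots> = (\<integral>\<omega>. \<integral>\<omega>'. f (\<omega>' t) \<partial>IT.eP t \<omega> \<partial>C t)"
    by (rule integral_bind_kernel[OF C eP ft])
  also have "\<dots> = (\<integral>\<omega>. \<integral>z. f z \<partial>step_law M \<pi> t \<omega> \<partial>C t)"
  proof (rule Bochner_Integration.integral_cong[OF refl])
    fix \<omega> assume "\<omega> \<in> space (C t)"
    then have \<omega>: "\<omega> \<in> space (?E t)" using prob_algebraD(2)[OF C] by simp
    have "fun_upd \<omega> t \<in> sa_space M \<rightarrow>\<^sub>M ?E (Suc t)"
      using \<omega> by (intro measurable_fun_upd[where J="{0..<t}"]) auto
    then have "fun_upd \<omega> t \<in> step_law M \<pi> t \<omega> \<rightarrow>\<^sub>M ?E (Suc t)"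
      using IT.sets_P[OF \<omega>] by (simp cong: measurable_cong_sets)
    then show "(\<integral>\<omega>'. f (\<omega>' t) \<partial>IT.eP t \<omega>) = (\<integral>z. f z \<partial>step_law M \<pi> t \<omega>)"
      unfolding IT.eP_def using bounded_measD(1)[OF ft] by (subst integral_distr) auto
  qed
  also have "\<dots> = (\<integral>\<omega>. \<integral>z. f z \<partial>step_law M \<pi> t \<omega> \<partial>distr ?L (?E t) (\<lambda>\<omega>. restrict \<omega> {0..<t}))"
    unfolding process_law_prefix[OF \<pi>] C_def ..
  also have "\<dots> = (\<integral>\<omega>. \<integral>z. f z \<partial>step_law M \<pi> t (restrict \<omega> {0..<t}) \<partial>?L)"
    using res[of t] bounded_measD(1)[OF bounded_meas_kernel_integral[OF step_law_measurable[OF \<pi>] f]]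
    by (subst integral_distr) auto
  finally show ?thesis .
qed

definition law_at :: "('s, 'a) policy \<Rightarrow> nat \<Rightarrow> ('s \<times> 'a) measure" where
  "law_at \<pi> t = distr (process_law M \<pi>) (sa_space M) (\<lambda>\<omega>. \<omega> t)"

lemma coordinate_measurable:
  assumes "\<pi> \<in> policies M"
  shows "(\<lambda>\<omega>. \<omega> t) \<in> process_law M \<pi> \<rightarrow>\<^sub>M sa_space M"
  by (auto simp: measurable_cong_sets[OF process_law_sets[OF assms] refl])

lemma law_at_prob:
  assumes "\<pi> \<in> policies M"
  shows "law_at \<pi> t \<in> space (prob_algebra (sa_space M))"
  using prob_space.prob_space_distr[OF prob_algebraD(3)[OF process_law_prob[OF assms]] coordinate_measurable[OF assms]]
  by (simp add: law_at_def space_prob_algebra)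

lemma integral_law_at:
  assumes \<pi>: "\<pi> \<in> policies M" and f: "f \<in> bounded_meas (sa_space M) B"
  shows "(\<integral>z. f z \<partial>law_at \<pi> t) = (\<integral>\<omega>. f (\<omega> t) \<partial>process_law M \<pi>)"
  unfolding law_at_def
  by (rule integral_distr[OF coordinate_measurable[OF \<pi>] bounded_measD(1)[OF f]])

lemma bounded_meas_fst:
  assumes "g \<in> bounded_meas (states M) B"
  shows "(\<lambda>z. g (fst z)) \<in> bounded_meas (sa_space M) B"
  using assms by (auto simp: bounded_meas_def space_pair_measure)

lemma restrict_process_law_space:
  assumes \<pi>: "\<pi> \<in> policies M" and "\<omega> \<in> space (process_law M \<pi>)"
  shows "restrict \<omega> {0..<t} \<in> space (Pi\<^sub>M {0..<t} (\<lambda>_. sa_space M))"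
  using assms(2) prob_algebraD(2)[OF process_law_prob[OF \<pi>]] by (auto simp: space_PiM PiE_iff)

text \<open>Integrating out the action at time \<open>t + 1\<close> removes the policy from the step law, so that only the
  transition kernel, evaluated at the pair of time \<open>t\<close>, remains.\<close>

lemma law_at_flow:
  assumes \<pi>: "\<pi> \<in> policies M" and g: "g \<in> bounded_meas (states M) B"
  shows "(\<integral>z. g (fst z) \<partial>law_at \<pi> (Suc t)) = (\<integral>z. \<integral>x. g x \<partial>trans M z \<partial>law_at \<pi> t)"
proof -
  note gf = bounded_meas_fst[OF g]
  have "(\<integral>z. g (fst z) \<partial>law_at \<pi> (Suc t)) =
    (\<integral>\<omega>. \<integral>z. g (fst z) \<partial>step_law M \<pi> (Suc t) (restrict \<omega> {0..<Suc t}) \<partial>process_law M \<pi>)"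
    using integral_law_at[OF \<pi> gf] integral_process_law_coordinate[OF \<pi> gf] by simp
  also have "\<dots> = (\<integral>\<omega>. \<integral>x. g x \<partial>trans M (\<omega> t) \<partial>process_law M \<pi>)"
  proof (rule Bochner_Integration.integral_cong[OF refl])
    fix \<omega> assume "\<omega> \<in> space (process_law M \<pi>)"
    note \<omega> = restrict_process_law_space[OF \<pi> this, of "Suc t"]
    let ?\<omega> = "restrict \<omega> {0..<Suc t}"
    have "(\<integral>z. g (fst z) \<partial>step_law M \<pi> (Suc t) ?\<omega>)
      = (\<integral>x. \<integral>a. g x \<partial>\<pi> (Suc t) (?\<omega>, x) \<partial>next_state (Suc t) ?\<omega>)"
      using integral_step_law[OF \<pi> \<omega> gf] by simp
    also have "\<dots> = (\<integral>x. g x \<partial>next_state (Suc t) ?\<omega>)"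
      using prob_algebraD(3)[OF measurable_space[OF policy_measurable_state[OF \<pi> \<omega>]]]
        prob_algebraD(2)[OF measurable_space[OF next_state_measurable \<omega>]]
      by (intro Bochner_Integration.integral_cong) (auto simp: prob_space.prob_space)
    finally show "(\<integral>z. g (fst z) \<partial>step_law M \<pi> (Suc t) ?\<omega>) = (\<integral>x. g x \<partial>trans M (\<omega> t))"
      by (simp add: next_state_def)
  qed
  also have "\<dots> = (\<integral>z. \<integral>x. g x \<partial>trans M z \<partial>law_at \<pi> t)"
    using integral_law_at[OF \<pi> bounded_meas_kernel_integral[OF trans_kernel g]] by simp
  finally show ?thesis .
qed

lemma stationary_in_policies:
  assumes \<phi>: "\<phi> \<in> stationary_policies M"
  shows "stationary \<phi> \<in> policies M"
  using measurable_compose[OF measurable_snd] \<phi>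
  by (auto simp: policies_def stationary_def stationary_policies_def)

text \<open>A stationary policy draws the action from the current state alone, so averaging \<open>f\<close> over the action
  leaves every conditional expectation given the past unchanged.\<close>

lemma law_at_stationary:
  assumes \<phi>: "\<phi> \<in> stationary_policies M" and f: "f \<in> bounded_meas (sa_space M) B"
  shows "(\<integral>z. f z \<partial>law_at (stationary \<phi>) t)
    = (\<integral>z. \<integral>a. f (fst z, a) \<partial>\<phi> (fst z) \<partial>law_at (stationary \<phi>) t)"
proof -
  note \<pi> = stationary_in_policies[OF \<phi>]
  have \<phi>': "\<phi> \<in> states M \<rightarrow>\<^sub>M prob_algebra (actions M)"
    using \<phi> by (simp add: stationary_policies_def)
  have f\<phi>: "(\<lambda>z. \<integral>a. f (fst z, a) \<partial>\<phi> (fst z)) \<in> bounded_meas (sa_space M) B"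
    using bounded_meas_fst[OF integral_pair_kernel(1)[OF \<phi>' f]] by simp
  show ?thesis
    unfolding integral_law_at[OF \<pi> f] integral_law_at[OF \<pi> f\<phi>]
      integral_process_law_coordinate[OF \<pi> f] integral_process_law_coordinate[OF \<pi> f\<phi>]
  proof (rule Bochner_Integration.integral_cong[OF refl])
    fix \<omega> assume "\<omega> \<in> space (process_law M (stationary \<phi>))"
    note \<omega> = restrict_process_law_space[OF \<pi> this, of t]
    show "(\<integral>z. f z \<partial>step_law M (stationary \<phi>) t (restrict \<omega> {0..<t})) =
      (\<integral>z. \<integral>a. f (fst z, a) \<partial>\<phi> (fst z) \<partial>step_law M (stationary \<phi>) t (restrict \<omega> {0..<t}))"
      unfolding integral_step_law[OF \<pi> \<omega> f] integral_step_law[OF \<pi> \<omega> f\<phi>]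
    proof (rule Bochner_Integration.integral_cong[OF refl])
      fix x assume "x \<in> space (next_state t (restrict \<omega> {0..<t}))"
      then have "prob_space (\<phi> x)"
        using prob_algebraD(2)[OF measurable_space[OF next_state_measurable \<omega>]]
          prob_algebraD(3)[OF measurable_space[OF \<phi>']] by auto
      then show "(\<integral>a. f (x, a) \<partial>stationary \<phi> t (restrict \<omega> {0..<t}, x)) =
          (\<integral>a. \<integral>b. f (fst (x, a), b) \<partial>\<phi> (fst (x, a)) \<partial>stationary \<phi> t (restrict \<omega> {0..<t}, x))"
        by (simp add: stationary_def prob_space.prob_space)
    qed
  qed
qed

text \<open>The law of the state-action pair at an independent, uniformly distributed time below \<open>T\<close>. Expected
  time averages over the first \<open>T\<close> steps are integrals against it.\<close>

definition occupation :: "('s, 'a) policy \<Rightarrow> nat \<Rightarrow> ('s \<times> 'a) measure" where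
  "occupation \<pi> T = measure_pmf (pmf_of_set {..<T}) \<bind> law_at \<pi>"

lemma law_at_kernel:
  assumes "\<pi> \<in> policies M"
  shows "law_at \<pi> \<in> count_space UNIV \<rightarrow>\<^sub>M prob_algebra (sa_space M)"
  using law_at_prob[OF assms] by simp

lemma measure_pmf_prob: "measure_pmf P \<in> space (prob_algebra (count_space UNIV))"
  by (simp add: space_prob_algebra measure_pmf.prob_space_axioms)

lemma occupation_prob:
  assumes "\<pi> \<in> policies M"
  shows "occupation \<pi> T \<in> space (prob_algebra (sa_space M))"
  unfolding occupation_def by (rule bind_in_prob_algebra[OF measure_pmf_prob law_at_kernel[OF assms]])

lemma integral_occupation:
  assumes \<pi>: "\<pi> \<in> policies M" and f: "f \<in> bounded_meas (sa_space M) B" and T: "0 < T"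
  shows "(\<integral>z. f z \<partial>occupation \<pi> T) = (\<Sum>t<T. \<integral>z. f z \<partial>law_at \<pi> t) / real T"
  unfolding occupation_def integral_bind_kernel[OF measure_pmf_prob law_at_kernel[OF \<pi>] f]
  using T by (subst integral_pmf_of_set) (auto simp: lessThan_empty_iff)

lemma average_eq_integral_occupation:
  assumes \<pi>: "\<pi> \<in> policies M" and f: "f \<in> bounded_meas (sa_space M) B" and T: "0 < T"
  shows "1 / real T * (\<integral>\<omega>. (\<Sum>t<T. f (\<omega> t)) \<partial>process_law M \<pi>) = (\<integral>z. f z \<partial>occupation \<pi> T)"
proof -
  have "integrable (process_law M \<pi>) (\<lambda>\<omega>. f (\<omega> t))" for t
    using bounded_meas_integrable[OF law_at_prob[OF \<pi>] f, of t] unfolding law_at_def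
    by (rule integrable_distr[OF coordinate_measurable[OF \<pi>]])
  then have "(\<integral>\<omega>. (\<Sum>t<T. f (\<omega> t)) \<partial>process_law M \<pi>) = (\<Sum>t<T. \<integral>z. f z \<partial>law_at \<pi> t)"
    by (simp add: integral_law_at[OF \<pi> f])
  then show ?thesis
    by (simp add: integral_occupation[OF \<pi> f T])
qed

text \<open>The two integrals are time averages of one sequence and of its shift by one step. The difference of
  the sums telescopes to two end terms, each of absolute value at most 1. This makes the state
  marginal of an occupation measure nearly invariant, for every policy.\<close>

lemma occupation_flow:
  assumes \<pi>: "\<pi> \<in> policies M" and g: "g \<in> bounded_meas (states M) 1" and T: "0 < T"
  shows "\<bar>(\<integral>z. \<integral>x. g x \<partial>trans M z \<partial>occupation \<pi> T) - (\<integral>z. g (fst z) \<partial>occupation \<pi> T)\<bar> \<le> 2 / real T"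
proof -
  let ?h = "\<lambda>t. \<integral>z. g (fst z) \<partial>law_at \<pi> t"
  have "(\<integral>z. \<integral>x. g x \<partial>trans M z \<partial>occupation \<pi> T) = (\<Sum>t<T. ?h (Suc t)) / real T"
    by (simp add: integral_occupation[OF \<pi> bounded_meas_kernel_integral[OF trans_kernel g] T]
        law_at_flow[OF \<pi> g])
  moreover have "(\<integral>z. g (fst z) \<partial>occupation \<pi> T) = (\<Sum>t<T. ?h t) / real T"
    by (rule integral_occupation[OF \<pi> bounded_meas_fst[OF g] T])
  moreover have "(\<Sum>t<T. ?h (Suc t)) - (\<Sum>t<T. ?h t) = ?h T - ?h 0"
    unfolding sum_subtractf[symmetric] by (rule sum_lessThan_telescope)
  ultimately have eq: "(\<integral>z. \<integral>x. g x \<partial>trans M z \<partial>occupation \<pi> T) - (\<integral>z. g (fst z) \<partial>occupation \<pi> T)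
      = (?h T - ?h 0) / real T"
    by (simp add: diff_divide_distrib[symmetric])
  have "\<bar>?h t\<bar> \<le> 1" for t
    by (rule bounded_meas_integral_le[OF law_at_prob[OF \<pi>] bounded_meas_fst[OF g]])
  from this[of T] this[of 0] have "\<bar>?h T - ?h 0\<bar> \<le> 2" by linarith
  then show ?thesis
    unfolding eq using T by (simp add: divide_right_mono)
qed

lemma occupation_stationary:
  assumes \<phi>: "\<phi> \<in> stationary_policies M" and f: "f \<in> bounded_meas (sa_space M) B" and T: "0 < T"
  shows "(\<integral>z. f z \<partial>occupation (stationary \<phi>) T)
    = (\<integral>z. \<integral>a. f (fst z, a) \<partial>\<phi> (fst z) \<partial>occupation (stationary \<phi>) T)"
proof -
  note \<pi> = stationary_in_policies[OF \<phi>]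
  have \<phi>': "\<phi> \<in> states M \<rightarrow>\<^sub>M prob_algebra (actions M)"
    using \<phi> by (simp add: stationary_policies_def)
  have f\<phi>: "(\<lambda>z. \<integral>a. f (fst z, a) \<partial>\<phi> (fst z)) \<in> bounded_meas (sa_space M) B"
    using bounded_meas_fst[OF integral_pair_kernel(1)[OF \<phi>' f]] by simp
  show ?thesis
    by (simp add: integral_occupation[OF \<pi> f T] integral_occupation[OF \<pi> f\<phi> T] law_at_stationary[OF \<phi> f])
qed

end

section \<open>Average cost of stationary policies\<close>

text \<open>The number \<open>t\<close> of steps is fixed first, so that the geometric term is small; after that the error
  \<open>h\<close>, multiplied by the constant \<open>t\<close>, vanishes in the limit.\<close>

lemma power_trade_off:
  fixes h :: "nat \<Rightarrow> real"
  assumes h: "h \<longlonglongrightarrow> 0" and \<kappa>: "0 < \<kappa>" "\<kappa> < 1" and e: "0 < e"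
  shows "\<exists>t\<ge>1. \<forall>\<^sub>F T in sequentially. real t * h T + R * \<kappa> ^ t < e"
proof -
  have "(\<lambda>t. R * \<kappa> ^ t) \<longlonglongrightarrow> R * 0"
    using \<kappa> by (intro tendsto_mult tendsto_const LIMSEQ_power_zero) auto
  then have "\<forall>\<^sub>F t in sequentially. R * \<kappa> ^ t < e"
    using e by (intro order_tendstoD) auto
  then have "\<forall>\<^sub>F t in sequentially. 1 \<le> t \<and> R * \<kappa> ^ t < e"
    using eventually_ge_at_top by (rule eventually_conj[rotated])
  then obtain t where t: "1 \<le> t" "R * \<kappa> ^ t < e"
    using eventually_happens'[OF sequentially_bot] by blast
  have "(\<lambda>T. real t * h T + R * \<kappa> ^ t) \<longlonglongrightarrow> real t * 0 + R * \<kappa> ^ t"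
    by (intro tendsto_intros h)
  then have "\<forall>\<^sub>F T in sequentially. real t * h T + R * \<kappa> ^ t < e"
    using t(2) by (intro order_tendstoD) auto
  with t(1) show ?thesis by blast
qed

context controlled_model
begin

lemma closed_loop_kernel:
  assumes "\<phi> \<in> stationary_policies M"
  shows "closed_loop M \<phi> \<in> states M \<rightarrow>\<^sub>M prob_algebra (states M)"
  unfolding closed_loop_def[abs_def]
  using assms trans_kernel
  by (intro measurable_bind_prob_space2[where N="actions M"]) (auto simp: stationary_policies_def)

lemma integral_closed_loop:
  assumes \<phi>: "\<phi> \<in> stationary_policies M" and x: "x \<in> space (states M)" and g: "g \<in> bounded_meas (states M) B"
  shows "(\<integral>y. g y \<partial>closed_loop M \<phi> x) = (\<integral>a. \<integral>y. g y \<partial>trans M (x, a) \<partial>\<phi> x)"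
  unfolding closed_loop_def
proof (rule integral_bind_kernel[OF _ _ g])
  show "\<phi> x \<in> space (prob_algebra (actions M))"
    using \<phi> x by (auto simp: stationary_policies_def dest: measurable_space)
  show "(\<lambda>a. trans M (x, a)) \<in> actions M \<rightarrow>\<^sub>M prob_algebra (states M)"
    using measurable_compose[OF measurable_Pair1'[OF x] trans_kernel] .
qed

definition state_marginal :: "('s \<times> 'a) measure \<Rightarrow> 's measure" where
  "state_marginal \<zeta> = distr \<zeta> (states M) fst"

lemma state_marginal:
  fixes g :: "'s \<Rightarrow> real"
  assumes \<zeta>: "\<zeta> \<in> space (prob_algebra (sa_space M))"
  shows "state_marginal \<zeta> \<in> space (prob_algebra (states M))"
    and "g \<in> borel_measurable (states M) \<Longrightarrow> (\<integral>x. g x \<partial>state_marginal \<zeta>) = (\<integral>z. g (fst z) \<partial>\<zeta>)"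
proof -
  have m: "fst \<in> \<zeta> \<rightarrow>\<^sub>M states M"
    using prob_algebraD(1)[OF \<zeta>] by (simp cong: measurable_cong_sets)
  show "state_marginal \<zeta> \<in> space (prob_algebra (states M))"
    using prob_space.prob_space_distr[OF prob_algebraD(3)[OF \<zeta>] m]
    by (simp add: state_marginal_def space_prob_algebra)
  show "(\<integral>x. g x \<partial>state_marginal \<zeta>) = (\<integral>z. g (fst z) \<partial>\<zeta>)" if "g \<in> borel_measurable (states M)"
    unfolding state_marginal_def by (rule integral_distr[OF m that])
qed

text \<open>One step of the closed loop from the state marginal of \<open>\<zeta>\<close> differs from a transition out of \<open>\<zeta>\<close> only
  in the choice of the action, at a price of \<open>E\<close>; a transition out of \<open>\<zeta>\<close> leads back to the state marginal
  up to \<open>D\<close>.\<close>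

lemma tv_dist_state_marginal_closed_loop:
  assumes \<zeta>: "\<zeta> \<in> space (prob_algebra (sa_space M))" and \<phi>: "\<phi> \<in> stationary_policies M"
    and flow: "\<And>g. g \<in> bounded_meas (states M) 1 \<Longrightarrow>
      \<bar>(\<integral>z. \<integral>x. g x \<partial>trans M z \<partial>\<zeta>) - (\<integral>z. g (fst z) \<partial>\<zeta>)\<bar> \<le> D"
    and approx: "\<And>g. g \<in> bounded_meas (states M) 1 \<Longrightarrow>
      \<bar>(\<integral>z. \<integral>a. \<integral>x. g x \<partial>trans M (fst z, a) \<partial>\<phi> (fst z) \<partial>\<zeta>) - (\<integral>z. \<integral>x. g x \<partial>trans M z \<partial>\<zeta>)\<bar> \<le> E"
  shows "tv_dist (state_marginal \<zeta> \<bind> closed_loop M \<phi>) (state_marginal \<zeta>) \<le> D + E"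
proof (rule tv_dist_le[OF bind_in_prob_algebra[OF state_marginal(1)[OF \<zeta>] closed_loop_kernel[OF \<phi>]]])
  fix g assume g: "g \<in> bounded_meas (states M) 1"
  have "(\<integral>x. g x \<partial>(state_marginal \<zeta> \<bind> closed_loop M \<phi>)) = (\<integral>x. \<integral>y. g y \<partial>closed_loop M \<phi> x \<partial>state_marginal \<zeta>)"
    by (rule integral_bind_kernel[OF state_marginal(1)[OF \<zeta>] closed_loop_kernel[OF \<phi>] g])
  also have "\<dots> = (\<integral>z. \<integral>y. g y \<partial>closed_loop M \<phi> (fst z) \<partial>\<zeta>)"
    by (rule state_marginal(2)[OF \<zeta> bounded_measD(1)[OF bounded_meas_kernel_integral[OF closed_loop_kernel[OF \<phi>] g]]])
  also have "\<dots> = (\<integral>z. \<integral>a. \<integral>x. g x \<partial>trans M (fst z, a) \<partial>\<phi> (fst z) \<partial>\<zeta>)"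
    using prob_algebraD(2)[OF \<zeta>]
    by (intro Bochner_Integration.integral_cong integral_closed_loop[OF \<phi> _ g]) (auto simp: space_pair_measure)
  finally show "\<bar>(\<integral>x. g x \<partial>(state_marginal \<zeta> \<bind> closed_loop M \<phi>)) - (\<integral>x. g x \<partial>state_marginal \<zeta>)\<bar> \<le> D + E"
    using flow[OF g] approx[OF g] state_marginal(2)[OF \<zeta> bounded_measD(1)[OF g]] by linarith
qed

end

locale ergodic_model = controlled_model M for M :: "('s, 'a) cmdp" +
  fixes R \<kappa>0 :: real
  assumes ergodic: "uniformly_ergodic M R \<kappa>0" and rate: "0 < \<kappa>0" "\<kappa>0 < 1"
begin

definition inv_law :: "('s \<Rightarrow> 'a measure) \<Rightarrow> 's measure" where
  "inv_law \<phi> = inv_measure (states M) (closed_loop M \<phi>)"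

lemma inv_law:
  assumes "\<phi> \<in> stationary_policies M"
  shows "inv_law \<phi> \<in> space (prob_algebra (states M))" "inv_law \<phi> \<bind> closed_loop M \<phi> = inv_law \<phi>"
proof -
  have "\<exists>!\<mu>. invariant_prob (states M) (closed_loop M \<phi>) \<mu>"
    using ergodic assms by (auto simp: uniformly_ergodic_def)
  from theI'[OF this]
  have "invariant_prob (states M) (closed_loop M \<phi>) (inv_law \<phi>)"
    by (simp add: inv_measure_def inv_law_def)
  then show "inv_law \<phi> \<in> space (prob_algebra (states M))" "inv_law \<phi> \<bind> closed_loop M \<phi> = inv_law \<phi>"
    by (auto simp: invariant_prob_def)
qed

lemma tv_dist_kernel_pow_inv_law:
  assumes "\<phi> \<in> stationary_policies M" "1 \<le> t" "x \<in> space (states M)"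
  shows "tv_dist (kernel_pow (states M) (closed_loop M \<phi>) t x) (inv_law \<phi>) \<le> R * \<kappa>0 ^ t"
  using ergodic assms by (auto simp: uniformly_ergodic_def inv_law_def)

lemma tv_dist_inv_law:
  assumes \<phi>: "\<phi> \<in> stationary_policies M" and \<mu>: "\<mu> \<in> space (prob_algebra (states M))"
    and D: "tv_dist (\<mu> \<bind> closed_loop M \<phi>) \<mu> \<le> D" and t: "1 \<le> t"
  shows "tv_dist \<mu> (inv_law \<phi>) \<le> real t * D + R * \<kappa>0 ^ t"
  by (rule tv_dist_near_invariant[OF \<mu> closed_loop_kernel[OF \<phi>] inv_law(1)[OF \<phi>] D
        tv_dist_kernel_pow_inv_law[OF \<phi> t]])

definition stationary_cost :: "('s \<times> 'a \<Rightarrow> real) \<Rightarrow> ('s \<Rightarrow> 'a measure) \<Rightarrow> real" where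
  "stationary_cost f \<phi> = (\<integral>x. \<integral>a. f (x, a) \<partial>\<phi> x \<partial>inv_law \<phi>)"

text \<open>The state marginals of the occupation measures are nearly invariant with defect \<open>2 / T\<close>, hence converge
  in total variation to the invariant law; the upper limit in the average cost is therefore a limit.\<close>

lemma avg_cost_stationary:
  assumes \<phi>: "\<phi> \<in> stationary_policies M" and f: "f \<in> bounded_meas (sa_space M) B"
  shows "avg_cost M f (stationary \<phi>) = ereal (stationary_cost f \<phi>)"
proof -
  note \<pi> = stationary_in_policies[OF \<phi>]
  let ?f = "\<lambda>x. \<integral>a. f (x, a) \<partial>\<phi> x" and ?\<zeta> = "occupation (stationary \<phi>)"
  have f\<phi>: "?f \<in> bounded_meas (states M) B"
    using integral_pair_kernel(1)[OF _ f] \<phi> by (simp add: stationary_policies_def)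
  have close: "\<bar>(\<integral>z. f z \<partial>?\<zeta> T) - stationary_cost f \<phi>\<bar> \<le> B * (real t * (2 / real T) + R * \<kappa>0 ^ t)"
    if T: "0 < T" and t: "1 \<le> t" for T t
  proof -
    note \<zeta> = occupation_prob[OF \<pi>, of T]
    have "tv_dist (state_marginal (?\<zeta> T) \<bind> closed_loop M \<phi>) (state_marginal (?\<zeta> T)) \<le> 2 / real T + 0"
    proof (rule tv_dist_state_marginal_closed_loop[OF \<zeta> \<phi> occupation_flow[OF \<pi> _ T]])
      fix g assume g: "g \<in> bounded_meas (states M) 1"
      show "\<bar>(\<integral>z. \<integral>a. \<integral>x. g x \<partial>trans M (fst z, a) \<partial>\<phi> (fst z) \<partial>?\<zeta> T)
          - (\<integral>z. \<integral>x. g x \<partial>trans M z \<partial>?\<zeta> T)\<bar> \<le> 0"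
        using occupation_stationary[OF \<phi> bounded_meas_kernel_integral[OF trans_kernel g] T] by simp
    qed
    then have "tv_dist (state_marginal (?\<zeta> T) \<bind> closed_loop M \<phi>) (state_marginal (?\<zeta> T)) \<le> 2 / real T"
      by simp
    note tv = tv_dist_inv_law[OF \<phi> state_marginal(1)[OF \<zeta>] this t]
    have "(\<integral>z. f z \<partial>?\<zeta> T) = (\<integral>x. ?f x \<partial>state_marginal (?\<zeta> T))"
      using occupation_stationary[OF \<phi> f T] state_marginal(2)[OF \<zeta> bounded_measD(1)[OF f\<phi>]] by simp
    then have "\<bar>(\<integral>z. f z \<partial>?\<zeta> T) - stationary_cost f \<phi>\<bar> \<le> B * tv_dist (state_marginal (?\<zeta> T)) (inv_law \<phi>)"
      using tv_dist_ge_scaled[OF state_marginal(1)[OF \<zeta>] inv_law(1)[OF \<phi>] f\<phi>]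
      by (simp add: stationary_cost_def)
    also have "\<dots> \<le> B * (real t * (2 / real T) + R * \<kappa>0 ^ t)"
      using tv bounded_meas_nonneg[OF \<zeta> f] by (rule mult_left_mono)
    finally show ?thesis .
  qed
  have "(\<lambda>T. \<integral>z. f z \<partial>?\<zeta> T) \<longlonglongrightarrow> stationary_cost f \<phi>"
  proof (rule tendstoI)
    fix e :: real assume e: "0 < e"
    have B: "0 \<le> B" by (rule bounded_meas_nonneg[OF occupation_prob[OF \<pi>] f])
    have "(\<lambda>T. 2 / real T) \<longlonglongrightarrow> 0"
      by (rule lim_const_over_n)
    from power_trade_off[OF this rate, of "e / (B + 1)" R] B e
    obtain t where t: "1 \<le> t" and ev: "\<forall>\<^sub>F T in sequentially. real t * (2 / real T) + R * \<kappa>0 ^ t < e / (B + 1)"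
      by auto
    from ev eventually_gt_at_top[of 0]
    show "\<forall>\<^sub>F T in sequentially. dist (\<integral>z. f z \<partial>?\<zeta> T) (stationary_cost f \<phi>) < e"
    proof eventually_elim
      case (elim T)
      have "B * (real t * (2 / real T) + R * \<kappa>0 ^ t) \<le> B * (e / (B + 1))"
        using elim B by (intro mult_left_mono) auto
      also have "\<dots> < e"
        using B e by (simp add: field_simps)
      finally have "B * (real t * (2 / real T) + R * \<kappa>0 ^ t) < e" .
      with close[OF elim(2) t] show ?case
        unfolding dist_real_def by linarith
    qed
  qed
  then have "(\<lambda>T. ereal (\<integral>z. f z \<partial>?\<zeta> T)) \<longlonglongrightarrow> ereal (stationary_cost f \<phi>)"
    by simp
  moreover have "\<forall>\<^sub>F T in sequentially. ereal (\<integral>z. f z \<partial>?\<zeta> T) =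
      ereal (1 / real T * (\<integral>\<omega>. (\<Sum>t<T. f (\<omega> t)) \<partial>process_law M (stationary \<phi>)))"
    using eventually_gt_at_top[of 0]
    by eventually_elim (simp only: average_eq_integral_occupation[OF \<pi> f])
  ultimately have "(\<lambda>T. ereal (1 / real T * (\<integral>\<omega>. (\<Sum>t<T. f (\<omega> t)) \<partial>process_law M (stationary \<phi>))))
      \<longlonglongrightarrow> ereal (stationary_cost f \<phi>)"
    by (rule Lim_transform_eventually)
  then show ?thesis
    unfolding avg_cost_def by (intro lim_imp_Limsup) auto
qed

end

section \<open>Stationary policies from conditioning on cells\<close>

lemma integral_uniform_measure:
  fixes f :: "_ \<Rightarrow> real"
  assumes M: "finite_measure M" and E: "E \<in> sets M" "measure M E \<noteq> 0" and f: "f \<in> borel_measurable M"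
  shows "(\<integral>x. f x \<partial>uniform_measure M E) = (\<integral>x. indicator E x * f x \<partial>M) / measure M E"
proof -
  interpret finite_measure M by fact
  have pos: "measure M E > 0" using E(2) by (simp add: zero_less_measure_iff)
  have "uniform_measure M E = density M (\<lambda>x. ennreal (indicator E x / measure M E))"
    unfolding uniform_measure_def using pos
    by (intro arg_cong2[where f=density] refl ext)
      (auto simp: emeasure_eq_measure divide_ennreal[symmetric] split: split_indicator)
  then have "(\<integral>x. f x \<partial>uniform_measure M E) = (\<integral>x. indicator E x / measure M E * f x \<partial>M)"
    using E f pos by (simp add: integral_density)
  also have "\<dots> = (\<integral>x. (indicator E x * f x) / measure M E \<partial>M)"
    by simp
  finally show ?thesis by simp
qed

context controlled_model
begin

text \<open>The conditional law under \<open>\<zeta>\<close> of the action, given that the quantized state is \<open>y\<close>. On cells of measure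
  zero the unconditional law of the action serves as an arbitrary probability measure.\<close>

definition cell_conditional :: "('s \<times> 'a) measure \<Rightarrow> ('s \<Rightarrow> 's) \<Rightarrow> 's \<Rightarrow> 'a measure" where
  "cell_conditional \<zeta> Q y =
     (let E = {z \<in> space \<zeta>. Q (fst z) = y}
      in distr (if measure \<zeta> E = 0 then \<zeta> else uniform_measure \<zeta> E) (actions M) snd)"

lemma cell_conditional_stationary:
  assumes \<zeta>: "\<zeta> \<in> space (prob_algebra (sa_space M))" and Q: "Q \<in> states M \<rightarrow>\<^sub>M count_space Y"
  shows "cell_conditional \<zeta> Q y \<in> space (prob_algebra (actions M))"
    and "(\<lambda>x. cell_conditional \<zeta> Q (Q x)) \<in> stationary_policies M"
proof -
  interpret prob_space \<zeta> by (rule prob_algebraD(3)[OF \<zeta>])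
  show *: "cell_conditional \<zeta> Q y \<in> space (prob_algebra (actions M))" for y
  proof -
    let ?E = "{z \<in> space \<zeta>. Q (fst z) = y}"
    let ?m = "if measure \<zeta> ?E = 0 then \<zeta> else uniform_measure \<zeta> ?E"
    have "prob_space ?m"
      using prob_space_axioms by (auto intro!: prob_space_uniform_measure simp: emeasure_eq_measure)
    moreover have "snd \<in> ?m \<rightarrow>\<^sub>M actions M"
      using prob_algebraD(1)[OF \<zeta>] by (simp cong: measurable_cong_sets)
    ultimately show ?thesis
      by (simp add: cell_conditional_def Let_def space_prob_algebra prob_space.prob_space_distr)
  qed
  show "(\<lambda>x. cell_conditional \<zeta> Q (Q x)) \<in> stationary_policies M"
    unfolding stationary_policies_def
    using measurable_compose[OF Q, of "cell_conditional \<zeta> Q"] * by simp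
qed

lemma quantized_state_measurable:
  assumes Q: "Q \<in> states M \<rightarrow>\<^sub>M count_space Y" and Y: "Y \<subseteq> space (states M)"
  shows "Q \<in> states M \<rightarrow>\<^sub>M states M"
  using measurable_compose[OF Q, of "\<lambda>y. y"] Y by auto

text \<open>For integrands that see the state only through its cell, elementary conditioning on the finitely many
  cells is an exact disintegration of \<open>\<zeta>\<close>.\<close>

lemma integral_cell_conditional:
  assumes \<zeta>: "\<zeta> \<in> space (prob_algebra (sa_space M))"
    and Q: "Q \<in> states M \<rightarrow>\<^sub>M count_space Y" and Y: "finite Y" "Y \<subseteq> space (states M)"
    and f: "f \<in> bounded_meas (sa_space M) B"
  shows "(\<integral>z. \<integral>a. f (Q (fst z), a) \<partial>cell_conditional \<zeta> Q (Q (fst z)) \<partial>\<zeta>) = (\<integral>z. f (Q (fst z), snd z) \<partial>\<zeta>)"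
proof -
  interpret prob_space \<zeta> by (rule prob_algebraD(3)[OF \<zeta>])
  let ?E = "\<lambda>y. {z \<in> space \<zeta>. Q (fst z) = y}"
  let ?k = "\<lambda>y. \<integral>a. f (y, a) \<partial>cell_conditional \<zeta> Q y"
  note sets_\<zeta> = prob_algebraD(1)[OF \<zeta>] and sp_\<zeta> = prob_algebraD(2)[OF \<zeta>]
  have Qf: "(\<lambda>z. Q (fst z)) \<in> \<zeta> \<rightarrow>\<^sub>M count_space Y"
    unfolding measurable_cong_sets[OF sets_\<zeta> refl] by (rule measurable_compose[OF measurable_fst Q])
  have QY: "Q (fst z) \<in> Y" if "z \<in> space \<zeta>" for z
    using measurable_space[OF Qf that] by simp
  have E: "?E y \<in> sets \<zeta>" if "y \<in> Y" for y
    using measurable_sets[OF Qf, of "{y}"] that by (simp add: vimage_def Int_def conj_commute)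
  have fy: "(\<lambda>a. f (y, a)) \<in> bounded_meas (actions M) B" if "y \<in> Y" for y
    using f that Y by (auto simp: bounded_meas_def space_pair_measure)
  have fyz: "(\<lambda>z. f (y, snd z)) \<in> bounded_meas \<zeta> B" if "y \<in> Y" for y
  proof (rule bounded_measI)
    show "(\<lambda>z. f (y, snd z)) \<in> borel_measurable \<zeta>"
      using measurable_compose[OF measurable_snd bounded_measD(1)[OF fy[OF that]]] sets_\<zeta>
      by (simp cong: measurable_cong_sets)
  qed (use f that Y sp_\<zeta> in \<open>auto simp: bounded_meas_def space_pair_measure\<close>)
  have int: "integrable \<zeta> (\<lambda>z. indicator (?E y) z * f (y, snd z))" if "y \<in> Y" for y
    using bounded_meas_integrable[OF _ fyz[OF that]] E[OF that] prob_space_axioms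
    by (intro integrable_real_mult_indicator[where f="\<lambda>z. f (y, snd z)", simplified mult.commute])
       (auto simp: space_prob_algebra)
  have cell: "measure \<zeta> (?E y) * ?k y = (\<integral>z. indicator (?E y) z * f (y, snd z) \<partial>\<zeta>)" if y: "y \<in> Y" for y
  proof (cases "measure \<zeta> (?E y) = 0")
    case True
    then have "?E y \<in> null_sets \<zeta>" using E[OF y] by (auto simp: emeasure_eq_measure)
    then have "AE z in \<zeta>. indicator (?E y) z * f (y, snd z) = 0"
      by (rule AE_mp[OF AE_not_in]) auto
    then have "(\<integral>z. indicator (?E y) z * f (y, snd z) \<partial>\<zeta>) = 0"
      by (rule integral_eq_zero_AE)
    with True show ?thesis by simp
  next
    case False
    have s: "snd \<in> uniform_measure \<zeta> (?E y) \<rightarrow>\<^sub>M actions M"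
      using sets_\<zeta> by (simp cong: measurable_cong_sets)
    have "?k y = (\<integral>z. f (y, snd z) \<partial>uniform_measure \<zeta> (?E y))"
      unfolding cell_conditional_def Let_def
      using False bounded_measD(1)[OF fy[OF y]] by (simp add: integral_distr[OF s])
    also have "\<dots> = (\<integral>z. indicator (?E y) z * f (y, snd z) \<partial>\<zeta>) / measure \<zeta> (?E y)"
      by (rule integral_uniform_measure[OF finite_measure_axioms E[OF y] False bounded_measD(1)[OF fyz[OF y]]])
    finally show ?thesis using False by simp
  qed
  have pick: "(\<Sum>y\<in>Y. indicator (?E y) z * h y) = h (Q (fst z))" if "z \<in> space \<zeta>" for z and h :: "'s \<Rightarrow> real"
  proof -
    have "(\<Sum>y\<in>Y. indicator (?E y) z * h y) = (\<Sum>y\<in>Y. if y = Q (fst z) then h y else 0)"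
      using that by (intro sum.cong) auto
    also have "\<dots> = h (Q (fst z))"
      using QY[OF that] Y(1) by simp
    finally show ?thesis .
  qed
  have "(\<integral>z. ?k (Q (fst z)) \<partial>\<zeta>) = (\<integral>z. (\<Sum>y\<in>Y. indicator (?E y) z * ?k y) \<partial>\<zeta>)"
    by (intro Bochner_Integration.integral_cong refl) (simp add: pick)
  also have "\<dots> = (\<Sum>y\<in>Y. measure \<zeta> (?E y) * ?k y)"
    using E by (subst Bochner_Integration.integral_sum) (auto simp: emeasure_eq_measure)
  also have "\<dots> = (\<Sum>y\<in>Y. \<integral>z. indicator (?E y) z * f (y, snd z) \<partial>\<zeta>)"
    using cell by simp
  also have "\<dots> = (\<integral>z. (\<Sum>y\<in>Y. indicator (?E y) z * f (y, snd z)) \<partial>\<zeta>)"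
    using int by (simp add: Bochner_Integration.integral_sum)
  also have "\<dots> = (\<integral>z. f (Q (fst z), snd z) \<partial>\<zeta>)"
    by (intro Bochner_Integration.integral_cong refl) (simp add: pick)
  finally show ?thesis .
qed

text \<open>The state is replaced by its quantization to make the disintegration exact, and put back afterwards.
  Each replacement costs \<open>\<eta>\<close>.\<close>

lemma integral_cell_conditional_approx:
  assumes \<zeta>: "\<zeta> \<in> space (prob_algebra (sa_space M))"
    and Q: "Q \<in> states M \<rightarrow>\<^sub>M count_space Y" and Y: "finite Y" "Y \<subseteq> space (states M)"
    and f: "f \<in> bounded_meas (sa_space M) B"
    and \<eta>: "\<And>x a. x \<in> space (states M) \<Longrightarrow> a \<in> space (actions M) \<Longrightarrow> \<bar>f (x, a) - f (Q x, a)\<bar> \<le> \<eta>"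
  shows "\<bar>(\<integral>z. \<integral>a. f (fst z, a) \<partial>cell_conditional \<zeta> Q (Q (fst z)) \<partial>\<zeta>) - (\<integral>z. f z \<partial>\<zeta>)\<bar> \<le> 2 * \<eta>"
proof -
  let ?\<phi> = "\<lambda>x. cell_conditional \<zeta> Q (Q x)"
  have \<phi>: "?\<phi> \<in> states M \<rightarrow>\<^sub>M prob_algebra (actions M)"
    using cell_conditional_stationary(2)[OF \<zeta> Q] by (simp add: stationary_policies_def)
  have QS: "Q \<in> states M \<rightarrow>\<^sub>M states M"
    by (rule quantized_state_measurable[OF Q Y(2)])
  have fQ: "(\<lambda>z. f (Q (fst z), snd z)) \<in> bounded_meas (sa_space M) B"
  proof (rule bounded_measI)
    have "(\<lambda>z. (Q (fst z), snd z)) \<in> sa_space M \<rightarrow>\<^sub>M sa_space M"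
      using QS by measurable
    from measurable_compose[OF this bounded_measD(1)[OF f]]
    show "(\<lambda>z. f (Q (fst z), snd z)) \<in> borel_measurable (sa_space M)" .
    show "\<bar>f (Q (fst z), snd z)\<bar> \<le> B" if "z \<in> space (sa_space M)" for z
      using that measurable_space[OF QS, of "fst z"]
      by (intro bounded_measD(2)[OF f]) (auto simp: space_pair_measure)
  qed
  have k1: "(\<lambda>z. \<integral>a. f (fst z, a) \<partial>?\<phi> (fst z)) \<in> bounded_meas (sa_space M) B"
    using bounded_meas_fst[OF integral_pair_kernel(1)[OF \<phi> f]] .
  have k2: "(\<lambda>z. \<integral>a. f (Q (fst z), a) \<partial>?\<phi> (fst z)) \<in> bounded_meas (sa_space M) B"
    using bounded_meas_fst[OF integral_pair_kernel(1)[OF \<phi> fQ]] by simp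
  have "\<bar>(\<integral>z. \<integral>a. f (fst z, a) \<partial>?\<phi> (fst z) \<partial>\<zeta>) - (\<integral>z. \<integral>a. f (Q (fst z), a) \<partial>?\<phi> (fst z) \<partial>\<zeta>)\<bar> \<le> \<eta>"
  proof (rule integral_diff_le[OF \<zeta> k1 k2])
    fix z assume "z \<in> space (sa_space M)"
    then have x: "fst z \<in> space (states M)" by (auto simp: space_pair_measure)
    show "\<bar>(\<integral>a. f (fst z, a) \<partial>?\<phi> (fst z)) - (\<integral>a. f (Q (fst z), a) \<partial>?\<phi> (fst z))\<bar> \<le> \<eta>"
      using \<eta>[OF x] integral_pair_kernel(2)[OF \<phi> f x] integral_pair_kernel(2)[OF \<phi> fQ x]
      by (intro integral_diff_le[OF measurable_space[OF \<phi> x]]) auto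
  qed
  moreover have "\<bar>(\<integral>z. f (Q (fst z), snd z) \<partial>\<zeta>) - (\<integral>z. f z \<partial>\<zeta>)\<bar> \<le> \<eta>"
  proof (rule integral_diff_le[OF \<zeta> fQ f])
    fix z assume "z \<in> space (sa_space M)"
    then show "\<bar>f (Q (fst z), snd z) - f z\<bar> \<le> \<eta>"
      using \<eta>[of "fst z" "snd z"] by (auto simp: space_pair_measure abs_minus_commute)
  qed
  ultimately show ?thesis
    unfolding integral_cell_conditional[OF \<zeta> Q Y f] by linarith
qed

text \<open>A coin with bias \<open>r\<close> decides once which of two policies is followed. All time averages then mix
  linearly, which is how a policy is combined with a strictly feasible one.\<close>

definition mixed_occupation :: "real \<Rightarrow> ('s, 'a) policy \<Rightarrow> ('s, 'a) policy \<Rightarrow> nat \<Rightarrow> ('s \<times> 'a) measure" where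
  "mixed_occupation r \<pi> \<pi>' T = measure_pmf (bernoulli_pmf r) \<bind> (\<lambda>b. occupation (if b then \<pi>' else \<pi>) T)"

lemma mixed_occupation:
  assumes \<pi>: "\<pi> \<in> policies M" "\<pi>' \<in> policies M" and r: "0 \<le> r" "r \<le> 1"
  shows "mixed_occupation r \<pi> \<pi>' T \<in> space (prob_algebra (sa_space M))"
    and "f \<in> bounded_meas (sa_space M) B \<Longrightarrow> (\<integral>z. f z \<partial>mixed_occupation r \<pi> \<pi>' T)
      = (1 - r) * (\<integral>z. f z \<partial>occupation \<pi> T) + r * (\<integral>z. f z \<partial>occupation \<pi>' T)"
proof -
  have k: "(\<lambda>b. occupation (if b then \<pi>' else \<pi>) T) \<in> count_space UNIV \<rightarrow>\<^sub>M prob_algebra (sa_space M)"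
    using occupation_prob[OF \<pi>(1), of T] occupation_prob[OF \<pi>(2), of T] by auto
  show "mixed_occupation r \<pi> \<pi>' T \<in> space (prob_algebra (sa_space M))"
    unfolding mixed_occupation_def by (rule bind_in_prob_algebra[OF measure_pmf_prob k])
  show "(\<integral>z. f z \<partial>mixed_occupation r \<pi> \<pi>' T)
      = (1 - r) * (\<integral>z. f z \<partial>occupation \<pi> T) + r * (\<integral>z. f z \<partial>occupation \<pi>' T)"
    if f: "f \<in> bounded_meas (sa_space M) B"
    unfolding mixed_occupation_def integral_bind_kernel[OF measure_pmf_prob k f]
    using r by (subst integral_bernoulli_pmf) auto
qed

lemma mixed_occupation_flow:
  assumes \<pi>: "\<pi> \<in> policies M" "\<pi>' \<in> policies M" and r: "0 \<le> r" "r \<le> 1"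
    and g: "g \<in> bounded_meas (states M) 1" and T: "0 < T"
  shows "\<bar>(\<integral>z. \<integral>x. g x \<partial>trans M z \<partial>mixed_occupation r \<pi> \<pi>' T)
    - (\<integral>z. g (fst z) \<partial>mixed_occupation r \<pi> \<pi>' T)\<bar> \<le> 2 / real T"
proof -
  let ?d = "\<lambda>\<pi>. (\<integral>z. \<integral>x. g x \<partial>trans M z \<partial>occupation \<pi> T) - (\<integral>z. g (fst z) \<partial>occupation \<pi> T)"
  have "(\<integral>z. \<integral>x. g x \<partial>trans M z \<partial>mixed_occupation r \<pi> \<pi>' T)
    - (\<integral>z. g (fst z) \<partial>mixed_occupation r \<pi> \<pi>' T) = (1 - r) * ?d \<pi> + r * ?d \<pi>'"
    unfolding mixed_occupation(2)[OF \<pi> r bounded_meas_kernel_integral[OF trans_kernel g]]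
      mixed_occupation(2)[OF \<pi> r bounded_meas_fst[OF g]]
    by (simp add: algebra_simps)
  also have "\<bar>\<dots>\<bar> \<le> (1 - r) * \<bar>?d \<pi>\<bar> + r * \<bar>?d \<pi>'\<bar>"
    using r by (intro order_trans[OF abs_triangle_ineq]) (simp add: abs_mult)
  also have "\<dots> \<le> (1 - r) * (2 / real T) + r * (2 / real T)"
    using r occupation_flow[OF \<pi>(1) g T] occupation_flow[OF \<pi>(2) g T] by (intro add_mono mult_left_mono) auto
  also have "\<dots> = 2 / real T"
    unfolding distrib_right[symmetric] by simp
  finally show ?thesis .
qed

end

context ergodic_model
begin

text \<open>The cell-conditional policy nearly fixes the state marginal of \<open>\<zeta>\<close>, with defect \<open>2 / T\<close> from the finite
  horizon and \<open>2 * D\<close> from conditioning on cells in place of states. Ergodicity turns this into a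
  distance to the invariant law.\<close>

lemma stationary_cost_cell_conditional:
  assumes \<pi>: "\<pi> \<in> policies M" "\<pi>' \<in> policies M" and r: "0 \<le> r" "r \<le> 1"
    and Q: "Q \<in> states M \<rightarrow>\<^sub>M count_space Y" and Y: "finite Y" "Y \<subseteq> space (states M)"
    and D: "\<And>x a. x \<in> space (states M) \<Longrightarrow> a \<in> space (actions M) \<Longrightarrow>
      tv_dist (trans M (x, a)) (trans M (Q x, a)) \<le> D"
    and f: "f \<in> bounded_meas (sa_space M) B"
    and \<eta>: "\<And>x a. x \<in> space (states M) \<Longrightarrow> a \<in> space (actions M) \<Longrightarrow> \<bar>f (x, a) - f (Q x, a)\<bar> \<le> \<eta>"
    and T: "0 < T" and t: "1 \<le> t"
  defines "\<zeta> \<equiv> mixed_occupation r \<pi> \<pi>' T"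
  shows "\<bar>stationary_cost f (\<lambda>x. cell_conditional \<zeta> Q (Q x)) - (\<integral>z. f z \<partial>\<zeta>)\<bar>
    \<le> B * (real t * (2 / real T + 2 * D) + R * \<kappa>0 ^ t) + 2 * \<eta>"
proof -
  let ?\<phi> = "\<lambda>x. cell_conditional \<zeta> Q (Q x)"
  have \<zeta>: "\<zeta> \<in> space (prob_algebra (sa_space M))"
    unfolding \<zeta>_def by (rule mixed_occupation(1)[OF \<pi> r])
  note \<phi> = cell_conditional_stationary(2)[OF \<zeta> Q]
  have f\<phi>: "(\<lambda>x. \<integral>a. f (x, a) \<partial>?\<phi> x) \<in> bounded_meas (states M) B"
    using integral_pair_kernel(1)[OF _ f] \<phi> by (simp add: stationary_policies_def)
  note \<mu> = state_marginal(1)[OF \<zeta>]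
  have "tv_dist (state_marginal \<zeta> \<bind> closed_loop M ?\<phi>) (state_marginal \<zeta>) \<le> 2 / real T + 2 * D"
  proof (rule tv_dist_state_marginal_closed_loop[OF \<zeta> \<phi>])
    fix g assume g: "g \<in> bounded_meas (states M) 1"
    show "\<bar>(\<integral>z. \<integral>x. g x \<partial>trans M z \<partial>\<zeta>) - (\<integral>z. g (fst z) \<partial>\<zeta>)\<bar> \<le> 2 / real T"
      unfolding \<zeta>_def by (rule mixed_occupation_flow[OF \<pi> r g T])
    show "\<bar>(\<integral>z. \<integral>a. \<integral>x. g x \<partial>trans M (fst z, a) \<partial>?\<phi> (fst z) \<partial>\<zeta>) - (\<integral>z. \<integral>x. g x \<partial>trans M z \<partial>\<zeta>)\<bar> \<le> 2 * D"
    proof (rule integral_cell_conditional_approx[OF \<zeta> Q Y bounded_meas_kernel_integral[OF trans_kernel g]])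
      fix x a assume xa: "x \<in> space (states M)" "a \<in> space (actions M)"
      have "Q x \<in> space (states M)"
        using measurable_space[OF Q xa(1)] Y(2) by auto
      then show "\<bar>(\<integral>y. g y \<partial>trans M (x, a)) - (\<integral>y. g y \<partial>trans M (Q x, a))\<bar> \<le> D"
        using xa by (intro order_trans[OF tv_dist_ge[OF measurable_space[OF trans_kernel] measurable_space[OF trans_kernel] g] D])
          (auto simp: space_pair_measure)
    qed
  qed
  note tv = tv_dist_inv_law[OF \<phi> \<mu> this t]
  have "\<bar>(\<integral>x. \<integral>a. f (x, a) \<partial>?\<phi> x \<partial>state_marginal \<zeta>) - stationary_cost f ?\<phi>\<bar>
      \<le> B * tv_dist (state_marginal \<zeta>) (inv_law ?\<phi>)"
    unfolding stationary_cost_def by (rule tv_dist_ge_scaled[OF \<mu> inv_law(1)[OF \<phi>] f\<phi>])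
  also have "\<dots> \<le> B * (real t * (2 / real T + 2 * D) + R * \<kappa>0 ^ t)"
    using tv bounded_meas_nonneg[OF \<zeta> f] by (rule mult_left_mono)
  finally have 1: "\<bar>(\<integral>x. \<integral>a. f (x, a) \<partial>?\<phi> x \<partial>state_marginal \<zeta>) - stationary_cost f ?\<phi>\<bar>
      \<le> B * (real t * (2 / real T + 2 * D) + R * \<kappa>0 ^ t)" .
  have 2: "\<bar>(\<integral>z. \<integral>a. f (fst z, a) \<partial>?\<phi> (fst z) \<partial>\<zeta>) - (\<integral>z. f z \<partial>\<zeta>)\<bar> \<le> 2 * \<eta>"
    by (rule integral_cell_conditional_approx[OF \<zeta> Q Y f \<eta>])
  show ?thesis
    using 1 2 unfolding state_marginal(2)[OF \<zeta> bounded_measD(1)[OF f\<phi>]] by linarith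
qed

lemma eventually_integral_occupation_less:
  assumes \<pi>: "\<pi> \<in> policies M" and f: "f \<in> bounded_meas (sa_space M) B"
    and v: "avg_cost M f \<pi> \<le> ereal v" and e: "0 < e"
  shows "\<forall>\<^sub>F T in sequentially. (\<integral>z. f z \<partial>occupation \<pi> T) < v + e"
proof -
  have "avg_cost M f \<pi> < ereal (v + e)"
    by (rule le_less_trans[OF v]) (use e in simp)
  then have "\<forall>\<^sub>F T in sequentially. ereal (1 / real T * (\<integral>\<omega>. (\<Sum>t<T. f (\<omega> t)) \<partial>process_law M \<pi>)) < ereal (v + e)"
    unfolding avg_cost_def by (rule Limsup_lessD)
  with eventually_gt_at_top[of 0] show ?thesis
  proof eventually_elim
    case (elim T)
    then show ?case by (simp only: average_eq_integral_occupation[OF \<pi> f] less_ereal.simps)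
  qed
qed

text \<open>History-dependent policies are reduced to stationary ones here. Instead of a weak limit of occupation
  measures and its disintegration, a single long horizon \<open>T\<close> is used, with conditioning on the cells of
  a fine grid: the time averages over this horizon are almost below their upper limits for finitely
  many costs at once, and the policy obtained by conditioning reproduces them up to the error of
  \<open>stationary_cost_cell_conditional\<close>.\<close>

lemma stationary_dominates_mixture:
  fixes f :: "'i \<Rightarrow> 's \<times> 'a \<Rightarrow> real"
  assumes \<pi>: "\<pi> \<in> policies M" "\<pi>' \<in> policies M" and r: "0 \<le> r" "r \<le> 1"
    and I: "finite I" "\<And>i. i \<in> I \<Longrightarrow> f i \<in> bounded_meas (sa_space M) (B i)"
    and Q: "\<And>T. 0 < T \<Longrightarrow> Q T \<in> states M \<rightarrow>\<^sub>M count_space (Y T)"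
    and Y: "\<And>T. 0 < T \<Longrightarrow> finite (Y T)" "\<And>T. 0 < T \<Longrightarrow> Y T \<subseteq> space (states M)"
    and h: "h \<longlonglongrightarrow> 0"
    and G: "\<And>T x a. 0 < T \<Longrightarrow> x \<in> space (states M) \<Longrightarrow> a \<in> space (actions M) \<Longrightarrow>
      tv_dist (trans M (x, a)) (trans M (Q T x, a)) \<le> G * h T"
    and L: "\<And>T x a i. i \<in> I \<Longrightarrow> 0 < T \<Longrightarrow> x \<in> space (states M) \<Longrightarrow> a \<in> space (actions M) \<Longrightarrow>
      \<bar>f i (x, a) - f i (Q T x, a)\<bar> \<le> L i * h T"
    and v: "\<And>i. i \<in> I \<Longrightarrow> avg_cost M (f i) \<pi> \<le> ereal (v i)"
    and v': "\<And>i. i \<in> I \<Longrightarrow> avg_cost M (f i) \<pi>' \<le> ereal (v' i)"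
    and e: "0 < e"
  shows "\<exists>\<phi>\<in>stationary_policies M. \<forall>i\<in>I. stationary_cost (f i) \<phi> \<le> (1 - r) * v i + r * v' i + e"
proof -
  define \<phi> where "\<phi> T = (\<lambda>x. cell_conditional (mixed_occupation r \<pi> \<pi>' T) (Q T) (Q T x))" for T
  have "\<forall>\<^sub>F T in sequentially. stationary_cost (f i) (\<phi> T) \<le> (1 - r) * v i + r * v' i + e" if iI: "i \<in> I" for i
  proof -
    note f = I(2)[OF iI]
    have B: "0 \<le> B i" by (rule bounded_meas_nonneg[OF occupation_prob[OF \<pi>(1)] f])
    have "(\<lambda>T. 2 / real T + 2 * (G * h T)) \<longlonglongrightarrow> 0 + 2 * (G * 0)"
      by (intro tendsto_intros h lim_const_over_n)
    then have "(\<lambda>T. 2 / real T + 2 * (G * h T)) \<longlonglongrightarrow> 0"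
      by simp
    from power_trade_off[OF this rate, of "e / 3 / (B i + 1)" R] B e
    obtain t where t: "1 \<le> t" and ev1: "\<forall>\<^sub>F T in sequentially.
        real t * (2 / real T + 2 * (G * h T)) + R * \<kappa>0 ^ t < e / 3 / (B i + 1)"
      by auto
    have "(\<lambda>T. 2 * (L i * h T)) \<longlonglongrightarrow> 2 * (L i * 0)"
      by (intro tendsto_intros h)
    then have ev2: "\<forall>\<^sub>F T in sequentially. 2 * (L i * h T) < e / 3"
      by (rule order_tendstoD(2)) (use e in simp)
    have e3: "0 < e / 3" using e by simp
    from ev1 ev2 eventually_integral_occupation_less[OF \<pi>(1) f v[OF iI] e3]
      eventually_integral_occupation_less[OF \<pi>(2) f v'[OF iI] e3] eventually_gt_at_top[of 0]
    show ?thesis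
    proof eventually_elim
      case (elim T)
      let ?\<zeta> = "mixed_occupation r \<pi> \<pi>' T"
      have "\<bar>stationary_cost (f i) (\<phi> T) - (\<integral>z. f i z \<partial>?\<zeta>)\<bar>
          \<le> B i * (real t * (2 / real T + 2 * (G * h T)) + R * \<kappa>0 ^ t) + 2 * (L i * h T)"
        unfolding \<phi>_def
        by (rule stationary_cost_cell_conditional[OF \<pi> r Q[OF elim(5)] Y[OF elim(5)] G[OF elim(5)] f
              L[OF iI elim(5)] elim(5) t])
      moreover have "B i * (real t * (2 / real T + 2 * (G * h T)) + R * \<kappa>0 ^ t) \<le> B i * (e / 3 / (B i + 1))"
        using elim(1) B by (intro mult_left_mono) auto
      moreover have "B i * (e / 3 / (B i + 1)) \<le> e / 3"
        using B e by (simp add: field_simps)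
      moreover have "(\<integral>z. f i z \<partial>?\<zeta>) \<le> (1 - r) * (v i + e / 3) + r * (v' i + e / 3)"
        unfolding mixed_occupation(2)[OF \<pi> r f] using elim(3,4) r by (intro add_mono mult_left_mono) auto
      moreover have "(1 - r) * (v i + e / 3) + r * (v' i + e / 3) = (1 - r) * v i + r * v' i + e / 3"
        by (simp add: field_simps)
      ultimately show ?case using elim(2) by linarith
    qed
  qed
  then have "\<forall>\<^sub>F T in sequentially. \<forall>i\<in>I. stationary_cost (f i) (\<phi> T) \<le> (1 - r) * v i + r * v' i + e"
    by (intro eventually_ball_finite[OF I(1)]) auto
  then have "\<forall>\<^sub>F T in sequentially. 0 < T \<and> (\<forall>i\<in>I. stationary_cost (f i) (\<phi> T) \<le> (1 - r) * v i + r * v' i + e)"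
    using eventually_gt_at_top by (rule eventually_conj[rotated])
  then obtain T where T: "0 < T" "\<forall>i\<in>I. stationary_cost (f i) (\<phi> T) \<le> (1 - r) * v i + r * v' i + e"
    using eventually_happens'[OF sequentially_bot] by blast
  moreover have "\<phi> T \<in> stationary_policies M"
    unfolding \<phi>_def by (rule cell_conditional_stationary(2)[OF mixed_occupation(1)[OF \<pi> r] Q[OF T(1)]])
  ultimately show ?thesis by blast
qed

end

section \<open>Perturbation of the transition law\<close>

lemma integral_close_to_const:
  assumes \<mu>: "\<mu> \<in> space (prob_algebra S)" and f: "f \<in> bounded_meas S B"
    and D: "AE x in \<mu>. \<bar>f x - k\<bar> \<le> D"
  shows "\<bar>(\<integral>x. f x \<partial>\<mu>) - k\<bar> \<le> D"
proof -
  interpret prob_space \<mu> by (rule prob_algebraD(3)[OF \<mu>])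
  note int = bounded_meas_integrable[OF \<mu> f]
  have "(\<integral>x. f x \<partial>\<mu>) - k = (\<integral>x. f x - k \<partial>\<mu>)"
    using int by (simp add: prob_space)
  also have "\<bar>\<dots>\<bar> \<le> (\<integral>x. \<bar>f x - k\<bar> \<partial>\<mu>)"
    by (rule integral_abs_bound)
  also have "\<dots> \<le> (\<integral>x. D \<partial>\<mu>)"
    using int D by (intro integral_mono_AE) auto
  finally show ?thesis by (simp add: prob_space)
qed

text \<open>With \<open>L = ln (1 / \<kappa>)\<close> and \<open>u = ln (2 * R * L / D)\<close>, the function \<open>t * D + 2 * R * \<kappa> ^ t\<close> of a real
  variable \<open>t\<close> attains its minimum \<open>D / L * (1 + u)\<close> at \<open>u / L\<close>. Twice this minimum leaves room for an
  integer: if \<open>u / L > 1\<close>, rounding it up at most doubles the linear term. If \<open>u / L \<le> 1\<close>, then \<open>t = 1\<close> must do,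
  although \<open>D\<close> alone may exceed the bound; there the cap \<open>2 * R * \<kappa>\<close> on the defect helps, because
  \<open>\<kappa> = exp (- L) \<le> exp (- u)\<close>.\<close>

lemma ceiling_trade_off:
  fixes R \<kappa> D :: real
  assumes R: "0 < R" and \<kappa>: "0 < \<kappa>" "\<kappa> < 1" and D: "0 < D" "D \<le> 2 * R * ln (1 / \<kappa>)"
  shows "\<exists>t\<ge>1. real t * min D (2 * R * \<kappa>) + R * \<kappa> ^ t
    \<le> 2 * (D / ln (1 / \<kappa>) * (1 + ln (2 * R * ln (1 / \<kappa>) / D)))"
proof -
  define L where "L = ln (1 / \<kappa>)"
  define u where "u = ln (2 * R * L / D)"
  have L: "0 < L" using \<kappa> by (simp add: L_def)
  have \<kappa>L: "\<kappa> = exp (- L)" using \<kappa> by (simp add: L_def ln_div)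
  have u: "0 \<le> u" using D L R unfolding u_def L_def[symmetric] by (simp add: divide_le_eq ln_ge_zero)
  have DL: "D / L = 2 * R * exp (- u)"
    using D L R by (simp add: u_def exp_minus field_simps)
  show ?thesis
  proof (cases "u \<le> L")
    case True
    have "real 1 * min D (2 * R * \<kappa>) + R * \<kappa> ^ 1 \<le> 3 * R * \<kappa>" by simp
    also have "\<dots> \<le> 3 * R * exp (- u)"
      using True R by (simp add: \<kappa>L)
    also have "\<dots> \<le> 4 * R * exp (- u) * (1 + u)"
      using R u by (simp add: distrib_left)
    also have "\<dots> = 2 * (D / L * (1 + u))" by (simp add: DL)
    finally show ?thesis unfolding L_def[symmetric] u_def[symmetric] by (intro exI[of _ 1]) simp
  next
    case False
    define t where "t = nat \<lceil>u / L\<rceil>"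
    have "1 < u / L" using False L by simp
    then have t1: "1 \<le> t" by (simp add: t_def le_nat_iff)
    have t: "u / L \<le> real t" "real t < u / L + 1"
      using u L by (auto simp: t_def) linarith
    have tl: "u \<le> L * real t" "L * real t < u + L"
      using t L by (simp_all add: field_simps)
    have "\<kappa> ^ t = exp (- (L * real t))"
      by (simp add: \<kappa>L exp_of_nat_mult[symmetric] mult.commute)
    also have "\<dots> \<le> exp (- u)" using tl by simp
    finally have "R * \<kappa> ^ t \<le> R * exp (- u)" using R by simp
    also have "\<dots> = D / L / 2" by (simp add: DL)
    finally have 1: "R * \<kappa> ^ t \<le> D / L / 2" .
    have "real t * min D (2 * R * \<kappa>) \<le> real t * D" by (simp add: mult_left_mono)
    also have "\<dots> = D / L * (L * real t)" using L by simp
    also have "\<dots> \<le> D / L * (2 * u)"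
      using tl False D L by (intro mult_left_mono) auto
    finally have "real t * min D (2 * R * \<kappa>) + R * \<kappa> ^ t \<le> D / L * (2 * u) + D / L / 2"
      using 1 by simp
    also have "\<dots> \<le> 2 * (D / L * (1 + u))"
    proof -
      have "w * (2 * u) + w / 2 \<le> 2 * (w * (1 + u))" if "0 \<le> w" for w :: real
        using that by (simp add: algebra_simps)
      from this[of "D / L"] D L show ?thesis by (simp only: divide_nonneg_pos less_imp_le)
    qed
    finally show ?thesis unfolding L_def[symmetric] u_def[symmetric] using t1 by blast
  qed
qed

context ergodic_model
begin

text \<open>Under the policy that always plays \<open>a\<close>, both transition laws are one-step laws of the same ergodic
  chain, so each lies within \<open>R * \<kappa>0\<close> of its invariant law.\<close>

lemma tv_dist_trans_le:
  assumes x: "x \<in> space (states M)" and y: "y \<in> space (states M)" and a: "a \<in> space (actions M)"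
  shows "tv_dist (trans M (x, a)) (trans M (y, a)) \<le> 2 * R * \<kappa>0"
proof -
  define \<psi> :: "'s \<Rightarrow> 'a measure" where "\<psi> = (\<lambda>_. return (actions M) a)"
  have \<psi>: "\<psi> \<in> stationary_policies M"
    using a by (simp add: \<psi>_def stationary_policies_def space_prob_algebra prob_space_return)
  note cl = closed_loop_kernel[OF \<psi>]
  have "tv_dist (trans M (w, a)) (inv_law \<psi>) \<le> R * \<kappa>0" if w: "w \<in> space (states M)" for w
  proof -
    have "(\<lambda>b. trans M (w, b)) \<in> actions M \<rightarrow>\<^sub>M prob_algebra (states M)"
      using measurable_compose[OF measurable_Pair1'[OF w] trans_kernel] .
    then have "closed_loop M \<psi> w = trans M (w, a)"
      unfolding closed_loop_def \<psi>_def using a by (intro bind_return[OF measurable_prob_algebraD]) auto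
    moreover have "kernel_pow (states M) (closed_loop M \<psi>) 1 w = closed_loop M \<psi> w"
      using bind_return[OF measurable_prob_algebraD[OF cl] w] by simp
    ultimately show ?thesis
      using tv_dist_kernel_pow_inv_law[OF \<psi> _ w, of 1] by simp
  qed
  from this[OF x] this[OF y] show ?thesis
    using tv_dist_triangle[of "trans M (x, a)" "states M" "inv_law \<psi>" "trans M (y, a)"]
      tv_dist_commute[of "inv_law \<psi>" "states M" "trans M (y, a)"]
      inv_law(1)[OF \<psi>] measurable_space[OF trans_kernel] x y a
    by (auto simp: space_pair_measure)
qed

end

text \<open>The invariant law of \<open>M'\<close> is invariant for \<open>M\<close> up to the defect \<open>D\<close>, hence close to the invariant law of
  \<open>M\<close>. The cost takes values in an interval of length \<open>C\<close>, so this distance enters with the factor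
  \<open>C / 2\<close>.\<close>

lemma stationary_cost_perturbation:
  assumes M: "ergodic_model M R \<kappa>0" and M': "ergodic_model M' R \<kappa>0"
    and same: "states M' = states M" "actions M' = actions M"
    and \<phi>: "\<phi> \<in> stationary_policies M"
    and D: "\<And>z. z \<in> space (sa_space M) \<Longrightarrow> tv_dist (trans M' z) (trans M z) \<le> D"
    and f: "f \<in> borel_measurable (sa_space M)" "\<And>z. z \<in> space (sa_space M) \<Longrightarrow> 0 \<le> f z"
      "\<And>z. z \<in> space (sa_space M) \<Longrightarrow> f z \<le> C"
    and f': "f' \<in> bounded_meas (sa_space M) C'"
    and \<eta>: "\<And>z. z \<in> space (sa_space M) \<Longrightarrow> \<bar>f z - f' z\<bar> \<le> \<eta>"
    and t: "1 \<le> t"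
  shows "\<bar>ergodic_model.stationary_cost M f \<phi> - ergodic_model.stationary_cost M' f' \<phi>\<bar>
    \<le> C / 2 * (real t * D + R * \<kappa>0 ^ t) + \<eta>"
proof -
  interpret M: ergodic_model M R \<kappa>0 by (rule M)
  interpret M': ergodic_model M' R \<kappa>0 by (rule M')
  have \<phi>': "\<phi> \<in> stationary_policies M'"
    using \<phi> by (simp add: stationary_policies_def same)
  have \<phi>k: "\<phi> \<in> states M \<rightarrow>\<^sub>M prob_algebra (actions M)"
    using \<phi> by (simp add: stationary_policies_def)
  note m = M.inv_law[OF \<phi>] and m' = M'.inv_law[OF \<phi>', unfolded same]
  have fb: "f \<in> bounded_meas (sa_space M) C"
    using f by (auto intro!: bounded_measI)
  have C: "0 \<le> C"
    by (rule bounded_meas_nonneg[OF m(1) integral_pair_kernel(1)[OF \<phi>k fb]])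
  have loop: "tv_dist (closed_loop M \<phi> x) (closed_loop M' \<phi> x) \<le> D" if x: "x \<in> space (states M)" for x
    unfolding closed_loop_def
  proof (rule tv_dist_bind_kernels)
    show "\<phi> x \<in> space (prob_algebra (actions M))" using measurable_space[OF \<phi>k x] .
    show k: "(\<lambda>a. trans M (x, a)) \<in> actions M \<rightarrow>\<^sub>M prob_algebra (states M)"
      using measurable_compose[OF measurable_Pair1'[OF x] M.trans_kernel] .
    show k': "(\<lambda>a. trans M' (x, a)) \<in> actions M \<rightarrow>\<^sub>M prob_algebra (states M)"
      using measurable_compose[OF measurable_Pair1'[OF x] M'.trans_kernel[unfolded same]] .
    show "tv_dist (trans M (x, a)) (trans M' (x, a)) \<le> D" if a: "a \<in> space (actions M)" for a
      using D[of "(x, a)"] x a tv_dist_commute[OF measurable_space[OF k a] measurable_space[OF k' a]]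
      by (simp add: space_pair_measure)
  qed
  have "tv_dist (M'.inv_law \<phi> \<bind> closed_loop M \<phi>) (M'.inv_law \<phi> \<bind> closed_loop M' \<phi>) \<le> D"
    by (rule tv_dist_bind_kernels[OF m'(1) M.closed_loop_kernel[OF \<phi>]
          M'.closed_loop_kernel[OF \<phi>', unfolded same] loop])
  then have "tv_dist (M'.inv_law \<phi> \<bind> closed_loop M \<phi>) (M'.inv_law \<phi>) \<le> D"
    by (simp add: m'(2))
  note tv = M.tv_dist_inv_law[OF \<phi> m'(1) this t]
  have pos: "0 \<le> (\<integral>a. f (x, a) \<partial>\<phi> x)" if x: "x \<in> space (states M)" for x
    using x f(2) prob_algebraD(2)[OF measurable_space[OF \<phi>k x]]
    by (intro Bochner_Integration.integral_nonneg) (auto simp: space_pair_measure)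
  have "\<bar>(\<integral>x. \<integral>a. f (x, a) \<partial>\<phi> x \<partial>M'.inv_law \<phi>) - M.stationary_cost f \<phi>\<bar>
      \<le> C / 2 * tv_dist (M'.inv_law \<phi>) (M.inv_law \<phi>)"
    unfolding M.stationary_cost_def
    using bounded_measD[OF integral_pair_kernel(1)[OF \<phi>k fb]] pos
    by (intro tv_dist_ge_range[OF m'(1) m(1)]) (auto simp: abs_le_iff)
  also have "\<dots> \<le> C / 2 * (real t * D + R * \<kappa>0 ^ t)"
    using tv C by (intro mult_left_mono) auto
  finally have 1: "\<bar>(\<integral>x. \<integral>a. f (x, a) \<partial>\<phi> x \<partial>M'.inv_law \<phi>) - M.stationary_cost f \<phi>\<bar>
      \<le> C / 2 * (real t * D + R * \<kappa>0 ^ t)" .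
  have 2: "\<bar>(\<integral>x. \<integral>a. f (x, a) \<partial>\<phi> x \<partial>M'.inv_law \<phi>) - M'.stationary_cost f' \<phi>\<bar> \<le> \<eta>"
    unfolding M'.stationary_cost_def
  proof (rule integral_diff_le[OF m'(1) integral_pair_kernel(1)[OF \<phi>k fb] integral_pair_kernel(1)[OF \<phi>k f']])
    fix x assume x: "x \<in> space (states M)"
    show "\<bar>(\<integral>a. f (x, a) \<partial>\<phi> x) - (\<integral>a. f' (x, a) \<partial>\<phi> x)\<bar> \<le> \<eta>"
      using \<eta> x
      by (intro integral_diff_le[OF measurable_space[OF \<phi>k x] integral_pair_kernel(2)[OF \<phi>k fb x]
            integral_pair_kernel(2)[OF \<phi>k f' x]]) (auto simp: space_pair_measure)
  qed
  from 1 2 show ?thesis by linarith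
qed

section \<open>Averaging over quantization cells\<close>

locale quantization =
  fixes X :: "'s::metric_space set" and A :: "'a::metric_space set"
    and Q :: "'s \<Rightarrow> 's" and \<nu> :: "'s measure" and Y :: "'s set" and \<delta> :: real
  assumes Q_measurable: "Q \<in> restrict_space borel X \<rightarrow>\<^sub>M count_space Y"
    and radius: "\<And>x. x \<in> X \<Longrightarrow> dist x (Q x) \<le> \<delta>"
    and \<nu>: "sets \<nu> = sets (restrict_space borel X)" "finite_measure \<nu>"
    and \<nu>_pos: "\<And>y. y \<in> Y \<Longrightarrow> 0 < emeasure \<nu> (cell X Q y)"
begin

abbreviation (input) "S \<equiv> restrict_space (borel :: 's measure) X"
abbreviation (input) "Act \<equiv> restrict_space (borel :: 'a measure) A"
abbreviation "cell_of x \<equiv> cell_measure X Q \<nu> (Q x)"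

definition cell_average :: "('s \<times> 'a \<Rightarrow> real) \<Rightarrow> 's \<times> 'a \<Rightarrow> real" where
  "cell_average f = (\<lambda>(x, a). \<integral>z. f (z, a) \<partial>cell_of x)"

lemma Q_in: "x \<in> X \<Longrightarrow> Q x \<in> Y"
  using measurable_space[OF Q_measurable] by (auto simp: space_restrict_space)

lemma cell_diameter:
  assumes "x \<in> X" "y \<in> X" "Q x = Q y"
  shows "dist x y \<le> 2 * \<delta>"
  using radius[OF assms(1)] radius[OF assms(2)] assms(3) dist_triangle2[of x y "Q x"] by simp

lemma cell_measure_prob:
  assumes y: "y \<in> Y"
  shows "cell_measure X Q \<nu> y \<in> space (prob_algebra S)"
    and "AE z in cell_measure X Q \<nu> y. z \<in> X \<and> Q z = y"
proof -
  interpret finite_measure \<nu> by (rule \<nu>(2))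
  have "cell X Q y = Q -` {y} \<inter> space S"
    by (auto simp: cell_def space_restrict_space)
  then have cell: "cell X Q y \<in> sets \<nu>"
    using measurable_sets[OF Q_measurable, of "{y}"] y \<nu>(1) by simp
  have "prob_space (cell_measure X Q \<nu> y)"
    unfolding cell_measure_def using \<nu>_pos[OF y] emeasure_finite
    by (intro prob_space_uniform_measure) auto
  then show "cell_measure X Q \<nu> y \<in> space (prob_algebra S)"
    by (simp add: space_prob_algebra cell_measure_def \<nu>(1))
  show "AE z in cell_measure X Q \<nu> y. z \<in> X \<and> Q z = y"
    unfolding cell_measure_def by (rule AE_uniform_measureI[OF cell]) (auto simp: cell_def)
qed

lemma cell_of_kernel: "(\<lambda>x. cell_of x) \<in> S \<rightarrow>\<^sub>M prob_algebra S"
  using measurable_compose[OF Q_measurable, of "cell_measure X Q \<nu>"] cell_measure_prob(1) by simp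

lemma section_bounded_meas:
  assumes f: "f \<in> bounded_meas (S \<Otimes>\<^sub>M Act) B" and a: "a \<in> A"
  shows "(\<lambda>z. f (z, a)) \<in> bounded_meas S B"
  using f a measurable_compose[OF measurable_Pair2' bounded_measD(1)[OF f], of a]
  by (auto simp: bounded_meas_def space_pair_measure space_restrict_space)

lemma cell_average_bounded_meas:
  assumes f: "f \<in> bounded_meas (S \<Otimes>\<^sub>M Act) B"
  shows "cell_average f \<in> bounded_meas (S \<Otimes>\<^sub>M Act) B"
proof -
  have N: "(\<lambda>w. cell_of (fst w)) \<in> S \<Otimes>\<^sub>M Act \<rightarrow>\<^sub>M prob_algebra S"
    using measurable_compose[OF measurable_fst cell_of_kernel] .
  have "(\<lambda>u. (snd u, snd (fst u))) \<in> (S \<Otimes>\<^sub>M Act) \<Otimes>\<^sub>M S \<rightarrow>\<^sub>M S \<Otimes>\<^sub>M Act"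
    by measurable
  from measurable_compose[OF this bounded_measD(1)[OF f]]
  have "(\<lambda>u. f (snd u, snd (fst u))) \<in> bounded_meas ((S \<Otimes>\<^sub>M Act) \<Otimes>\<^sub>M S) B"
    using bounded_measD(2)[OF f] by (auto intro!: bounded_measI simp: space_pair_measure)
  from integral_pair_kernel(1)[OF N this] show ?thesis
    by (simp add: cell_average_def case_prod_beta')
qed

lemma cell_average_close:
  assumes f: "f \<in> bounded_meas (S \<Otimes>\<^sub>M Act) B"
    and L: "\<And>a. a \<in> A \<Longrightarrow> L-lipschitz_on X (\<lambda>x. f (x, a))" and x: "x \<in> X" and a: "a \<in> A"
  shows "\<bar>f (x, a) - cell_average f (x, a)\<bar> \<le> 2 * L * \<delta>"
proof -
  note lip = L[OF a]
  have "\<bar>(\<integral>z. f (z, a) \<partial>cell_of x) - f (x, a)\<bar> \<le> L * (2 * \<delta>)"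
  proof (rule integral_close_to_const[OF cell_measure_prob(1)[OF Q_in[OF x]] section_bounded_meas[OF f a]])
    show "AE z in cell_of x. \<bar>f (z, a) - f (x, a)\<bar> \<le> L * (2 * \<delta>)"
      using cell_measure_prob(2)[OF Q_in[OF x]]
    proof eventually_elim
      case (elim z)
      then have "\<bar>f (z, a) - f (x, a)\<bar> \<le> L * dist z x"
        using lipschitz_onD[OF lip, of z x] x by (simp add: dist_real_def)
      also have "\<dots> \<le> L * (2 * \<delta>)"
        using elim x cell_diameter[of z x] lipschitz_on_nonneg[OF lip] by (intro mult_left_mono) auto
      finally show ?case .
    qed
  qed
  then show ?thesis by (simp add: cell_average_def abs_minus_commute mult.commute mult.left_commute)
qed

lemma extended_trans:
  assumes p: "p \<in> S \<Otimes>\<^sub>M Act \<rightarrow>\<^sub>M prob_algebra S"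
  shows "(\<lambda>(x, a). cell_of x \<bind> (\<lambda>z. p (z, a))) \<in> S \<Otimes>\<^sub>M Act \<rightarrow>\<^sub>M prob_algebra S"
proof -
  have N: "(\<lambda>w. cell_of (fst w)) \<in> S \<Otimes>\<^sub>M Act \<rightarrow>\<^sub>M prob_algebra S"
    using measurable_compose[OF measurable_fst cell_of_kernel] .
  have "(\<lambda>u. (snd u, snd (fst u))) \<in> (S \<Otimes>\<^sub>M Act) \<Otimes>\<^sub>M S \<rightarrow>\<^sub>M S \<Otimes>\<^sub>M Act"
    by measurable
  from measurable_compose[OF this p]
  have "(\<lambda>(w, z). p (z, snd w)) \<in> (S \<Otimes>\<^sub>M Act) \<Otimes>\<^sub>M S \<rightarrow>\<^sub>M prob_algebra S"
    by (simp add: case_prod_beta')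
  from measurable_bind_prob_space2[OF N this] show ?thesis
    by (simp add: case_prod_beta')
qed

text \<open>The law on the left averages the laws \<open>p (y, a)\<close> over points \<open>y\<close> of the cell of \<open>x\<close>, and balls in total
  variation are convex.\<close>

lemma tv_dist_extended_trans:
  assumes p: "p \<in> S \<Otimes>\<^sub>M Act \<rightarrow>\<^sub>M prob_algebra S"
    and D: "\<And>y. y \<in> X \<Longrightarrow> Q y = Q x \<Longrightarrow> tv_dist (p (y, a)) (p (x, a)) \<le> D"
    and x: "x \<in> X" and a: "a \<in> A"
  shows "tv_dist (cell_of x \<bind> (\<lambda>z. p (z, a))) (p (x, a)) \<le> D"
proof -
  note m = cell_measure_prob[OF Q_in[OF x]]
  have k: "(\<lambda>z. p (z, a)) \<in> S \<rightarrow>\<^sub>M prob_algebra S"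
    using measurable_compose[OF measurable_Pair2' p, of a] a by (simp add: space_restrict_space)
  show ?thesis
  proof (rule tv_dist_le[OF bind_in_prob_algebra[OF m(1) k]])
    fix g assume g: "g \<in> bounded_meas S 1"
    have "\<bar>(\<integral>z. \<integral>y. g y \<partial>p (z, a) \<partial>cell_of x) - (\<integral>y. g y \<partial>p (x, a))\<bar> \<le> D"
    proof (rule integral_close_to_const[OF m(1) bounded_meas_kernel_integral[OF k g]])
      show "AE z in cell_of x. \<bar>(\<integral>y. g y \<partial>p (z, a)) - (\<integral>y. g y \<partial>p (x, a))\<bar> \<le> D"
        using m(2)
      proof eventually_elim
        case (elim z)
        then show ?case
          using x by (intro order_trans[OF tv_dist_ge[OF measurable_space[OF k] measurable_space[OF k] g] D])
            (auto simp: space_restrict_space)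
      qed
    qed
    then show "\<bar>(\<integral>y. g y \<partial>(cell_of x \<bind> (\<lambda>z. p (z, a)))) - (\<integral>y. g y \<partial>p (x, a))\<bar> \<le> D"
      by (simp add: integral_bind_kernel[OF m(1) k g])
  qed
qed

end

text \<open>\<open>f\<close> is the limit of the functions \<open>(x, a) \<mapsto> f (Q i x, a)\<close>, which are measurable because each
  quantizer takes finitely many values. This avoids a comparison of the Borel sets of \<open>X \<times> A\<close> with the
  product \<open>\<sigma>\<close>-algebra.\<close>

lemma caratheodory_lipschitz_measurable:
  fixes X :: "'s::metric_space set" and A :: "'a::metric_space set" and f :: "'s \<times> 'a \<Rightarrow> real"
  assumes Q: "\<And>i. 1 \<le> i \<Longrightarrow> Q i \<in> restrict_space borel X \<rightarrow>\<^sub>M count_space (Y i)"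
    and Y: "\<And>i. 1 \<le> i \<Longrightarrow> finite (Y i)" "\<And>i. 1 \<le> i \<Longrightarrow> Y i \<subseteq> X"
    and h: "h \<longlonglongrightarrow> 0" "\<And>i x. 1 \<le> i \<Longrightarrow> x \<in> X \<Longrightarrow> dist x (Q i x) \<le> h i"
    and cont: "continuous_on (X \<times> A) f"
    and lip: "\<And>a. a \<in> A \<Longrightarrow> L-lipschitz_on X (\<lambda>x. f (x, a))"
  shows "f \<in> borel_measurable (restrict_space borel X \<Otimes>\<^sub>M restrict_space borel A)"
    (is "f \<in> borel_measurable (?S \<Otimes>\<^sub>M ?A)")
proof (rule borel_measurable_LIMSEQ_metric)
  fix i :: nat
  have "(\<lambda>w. f (Q (Suc i) (fst w), snd w)) \<in> borel_measurable (?S \<Otimes>\<^sub>M ?A)"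
  proof (rule measurable_compose_countable'[where I="Y (Suc i)" and g="\<lambda>w. Q (Suc i) (fst w)" and f="\<lambda>y w. f (y, snd w)"])
    fix y assume "y \<in> Y (Suc i)"
    then have "y \<in> X" using Y(2)[of "Suc i"] by auto
    then have "continuous_on A (\<lambda>a. f (y, a))"
      by (intro continuous_on_compose2[OF cont] continuous_intros) auto
    then have "(\<lambda>a. f (y, a)) \<in> borel_measurable ?A"
      by (rule borel_measurable_continuous_on_restrict)
    then show "(\<lambda>w. f (y, snd w)) \<in> borel_measurable (?S \<Otimes>\<^sub>M ?A)"
      by (rule measurable_compose[OF measurable_snd])
  next
    show "(\<lambda>w. Q (Suc i) (fst w)) \<in> ?S \<Otimes>\<^sub>M ?A \<rightarrow>\<^sub>M count_space (Y (Suc i))"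
      by (rule measurable_compose[OF measurable_fst Q]) simp
  qed (use Y(1)[of "Suc i"] in \<open>simp add: countable_finite\<close>)
  then show "(\<lambda>w. f (Q (Suc i) (fst w), snd w)) \<in> borel_measurable (?S \<Otimes>\<^sub>M ?A)" .
next
  fix w assume "w \<in> space (?S \<Otimes>\<^sub>M ?A)"
  then have w: "fst w \<in> X" "snd w \<in> A"
    by (auto simp: space_pair_measure space_restrict_space)
  have QX: "Q (Suc i) (fst w) \<in> X" for i
    using measurable_space[OF Q, of "Suc i" "fst w"] w(1) Y(2)[of "Suc i"] by (auto simp: space_restrict_space)
  have "(\<lambda>i. L * h (Suc i)) \<longlonglongrightarrow> L * 0"
    by (intro tendsto_intros LIMSEQ_Suc h(1))
  then have lim0: "(\<lambda>i. L * h (Suc i)) \<longlonglongrightarrow> 0" by simp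
  show "(\<lambda>i. f (Q (Suc i) (fst w), snd w)) \<longlonglongrightarrow> f w"
  proof (rule tendsto_dist_iff[THEN iffD2], rule tendsto_sandwich[OF _ _ tendsto_const lim0])
    have "dist (f (Q (Suc i) (fst w), snd w)) (f w) \<le> L * h (Suc i)" for i
    proof -
      have "dist (f (Q (Suc i) (fst w), snd w)) (f w) \<le> L * dist (Q (Suc i) (fst w)) (fst w)"
        using lipschitz_onD[OF lip[OF w(2)] QX w(1)] by simp
      also have "\<dots> \<le> L * h (Suc i)"
        using h(2)[of "Suc i", OF _ w(1)] lipschitz_on_nonneg[OF lip[OF w(2)]]
        by (intro mult_left_mono) (auto simp: dist_commute)
      finally show ?thesis .
    qed
    then show "\<forall>\<^sub>F i in sequentially. dist (f (Q (Suc i) (fst w), snd w)) (f w) \<le> L * h (Suc i)"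
      by simp
  qed simp
qed

section \<open>Near-optimality of the extended policy\<close>

context controlled_model
begin

lemma avg_cost_bounds:
  assumes \<pi>: "\<pi> \<in> policies M" and f: "f \<in> borel_measurable (sa_space M)"
    and f0: "\<And>z. z \<in> space (sa_space M) \<Longrightarrow> 0 \<le> f z" and fC: "\<And>z. z \<in> space (sa_space M) \<Longrightarrow> f z \<le> C"
  shows "0 \<le> avg_cost M f \<pi>" "avg_cost M f \<pi> \<le> ereal C"
proof -
  have fb: "f \<in> bounded_meas (sa_space M) C"
    using f f0 fC by (auto intro!: bounded_measI)
  have *: "0 \<le> (\<integral>z. f z \<partial>occupation \<pi> T)" "(\<integral>z. f z \<partial>occupation \<pi> T) \<le> C" for T
    using bounded_meas_integral_le[OF occupation_prob[OF \<pi>] fb, of T] f0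
      prob_algebraD(2)[OF occupation_prob[OF \<pi>], of T]
    by (auto intro!: Bochner_Integration.integral_nonneg)
  have ev: "\<forall>\<^sub>F T in sequentially. ereal (1 / real T * (\<integral>\<omega>. (\<Sum>t<T. f (\<omega> t)) \<partial>process_law M \<pi>)) \<ge> 0
      \<and> ereal (1 / real T * (\<integral>\<omega>. (\<Sum>t<T. f (\<omega> t)) \<partial>process_law M \<pi>)) \<le> ereal C"
    using eventually_gt_at_top[of 0]
    by eventually_elim (use * in \<open>simp only: average_eq_integral_occupation[OF \<pi> fb] ereal_less_eq zero_ereal_def\<close>)
  show "avg_cost M f \<pi> \<le> ereal C"
    unfolding avg_cost_def by (rule Limsup_bounded) (use ev in eventually_elim, simp)
  show "0 \<le> avg_cost M f \<pi>"
    unfolding avg_cost_def by (rule le_Limsup) (use ev in \<open>auto elim: eventually_mono\<close>)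
qed

end

text \<open>The index 0 stands for the cost, so that cost and constraints are treated alike.\<close>

definition criterion :: "('s, 'a) cmdp \<Rightarrow> nat \<Rightarrow> 's \<times> 'a \<Rightarrow> real" where
  "criterion M l = (if l = 0 then cost M else constr M l)"

text \<open>Suppose that each criterion \<open>l\<close> of a stationary policy changes by at most \<open>err l\<close> between \<open>M\<close> and \<open>E\<close>.
  Feasibility passes from \<open>E\<close> to \<open>M\<close> because the bounds were tightened by \<open>\<epsilon> \<ge> err l\<close>. For optimality, a
  policy feasible in \<open>M\<close> receives an admixture \<open>r\<close> of the strictly feasible policy \<open>\<pi>S\<close> and is then made
  stationary. The mixture gains \<open>r * m\<close> in every constraint, which for \<open>r\<close> slightly above
  \<open>(\<epsilon> + e) / m\<close> covers the tightening and the change of model; it raises the cost by at most \<open>r * C 0\<close>.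
  Comparing costs in \<open>E\<close> and returning to \<open>M\<close> adds \<open>2 * err 0\<close>.\<close>

lemma near_optimal_of_stationary_approximation:
  fixes M E :: "('s, 'a) cmdp" and C C' err L k \<alpha>' :: "nat \<Rightarrow> real"
  assumes M: "ergodic_model M R \<kappa>0" and E: "ergodic_model E R' \<kappa>0'"
    and same: "states E = states M" "actions E = actions M"
    and crit: "\<And>l. l \<le> q \<Longrightarrow> criterion M l \<in> borel_measurable (sa_space M)"
      "\<And>l z. l \<le> q \<Longrightarrow> z \<in> space (sa_space M) \<Longrightarrow> 0 \<le> criterion M l z"
      "\<And>l z. l \<le> q \<Longrightarrow> z \<in> space (sa_space M) \<Longrightarrow> criterion M l z \<le> C l"
    and crit': "\<And>l. l \<le> q \<Longrightarrow> criterion E l \<in> bounded_meas (sa_space M) (C' l)"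
    and close: "\<And>\<phi> l. \<phi> \<in> stationary_policies M \<Longrightarrow> l \<le> q \<Longrightarrow>
      \<bar>ergodic_model.stationary_cost M (criterion M l) \<phi> - ergodic_model.stationary_cost E (criterion E l) \<phi>\<bar> \<le> err l"
    and Q: "\<And>T. 0 < T \<Longrightarrow> Q T \<in> states M \<rightarrow>\<^sub>M count_space (Y T)"
    and Y: "\<And>T. 0 < T \<Longrightarrow> finite (Y T)" "\<And>T. 0 < T \<Longrightarrow> Y T \<subseteq> space (states M)"
    and h: "h \<longlonglongrightarrow> 0"
    and G: "\<And>T x a. 0 < T \<Longrightarrow> x \<in> space (states M) \<Longrightarrow> a \<in> space (actions M) \<Longrightarrow>
      tv_dist (trans M (x, a)) (trans M (Q T x, a)) \<le> G * h T"
    and L: "\<And>T x a l. l \<le> q \<Longrightarrow> 0 < T \<Longrightarrow> x \<in> space (states M) \<Longrightarrow> a \<in> space (actions M) \<Longrightarrow>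
      \<bar>criterion M l (x, a) - criterion M l (Q T x, a)\<bar> \<le> L l * h T"
    and slater: "\<pi>S \<in> policies M" "\<And>l. l \<in> {1..q} \<Longrightarrow> avg_cost M (constr M l) \<pi>S \<le> ereal (k l - \<alpha>' l)"
    and m: "0 < m" "\<And>l. l \<in> {1..q} \<Longrightarrow> m \<le> \<alpha>' l"
    and err: "\<And>l. l \<in> {1..q} \<Longrightarrow> err l \<le> e" "0 \<le> e" "e \<le> \<epsilon>" "\<epsilon> + e < m"
    and \<kappa>: "2 * err 0 + (\<epsilon> + e) / m * C 0 < \<kappa>"
    and \<phi>: "\<phi> \<in> stationary_policies M" "optimal E q (\<lambda>l. k l - \<epsilon>) (stationary \<phi>)"
  shows "feasible M q k (stationary \<phi>)"
    and "\<bar>avg_cost M (cost M) (stationary \<phi>) - opt_value M q k\<bar> \<le> ereal \<kappa>"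
proof -
  interpret M: ergodic_model M R \<kappa>0 by (rule M)
  interpret E: ergodic_model E R' \<kappa>0' by (rule E)
  have stE: "\<psi> \<in> stationary_policies E" if "\<psi> \<in> stationary_policies M" for \<psi>
    using that by (simp add: stationary_policies_def same)
  have critb: "criterion M l \<in> bounded_meas (sa_space M) (C l)" if "l \<le> q" for l
    using crit[OF that] by (auto intro!: bounded_measI)
  have avgM: "avg_cost M (criterion M l) (stationary \<psi>) = ereal (M.stationary_cost (criterion M l) \<psi>)"
    if "\<psi> \<in> stationary_policies M" "l \<le> q" for \<psi> l
    by (rule M.avg_cost_stationary[OF that(1) critb[OF that(2)]])
  have avgE: "avg_cost E (criterion E l) (stationary \<psi>) = ereal (E.stationary_cost (criterion E l) \<psi>)"
    if "\<psi> \<in> stationary_policies M" "l \<le> q" for \<psi> l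
    using E.avg_cost_stationary[OF stE[OF that(1)]] crit'[OF that(2)] by (simp add: same)
  have feasM: "feasible M q b (stationary \<psi>) \<longleftrightarrow> (\<forall>l\<in>{1..q}. M.stationary_cost (criterion M l) \<psi> \<le> b l)"
    if \<psi>: "\<psi> \<in> stationary_policies M" for \<psi> b
  proof -
    have "avg_cost M (constr M l) (stationary \<psi>) = ereal (M.stationary_cost (criterion M l) \<psi>)"
      if "l \<in> {1..q}" for l
      using avgM[OF \<psi>, of l] that by (auto simp: criterion_def)
    then show ?thesis
      using M.stationary_in_policies[OF \<psi>] by (simp add: feasible_def)
  qed
  have feasE: "feasible E q b (stationary \<psi>) \<longleftrightarrow> (\<forall>l\<in>{1..q}. E.stationary_cost (criterion E l) \<psi> \<le> b l)"
    if \<psi>: "\<psi> \<in> stationary_policies M" for \<psi> b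
  proof -
    have "avg_cost E (constr E l) (stationary \<psi>) = ereal (E.stationary_cost (criterion E l) \<psi>)"
      if "l \<in> {1..q}" for l
      using avgE[OF \<psi>, of l] that by (auto simp: criterion_def)
    then show ?thesis
      using E.stationary_in_policies[OF stE[OF \<psi>]] by (simp add: feasible_def)
  qed
  have C0: "0 \<le> C 0"
    by (rule bounded_meas_nonneg[OF M.occupation_prob[OF slater(1)] critb]) simp
  show feas: "feasible M q k (stationary \<phi>)"
    unfolding feasM[OF \<phi>(1)]
  proof
    fix l assume l: "l \<in> {1..q}"
    have "feasible E q (\<lambda>l. k l - \<epsilon>) (stationary \<phi>)"
      using \<phi>(2) by (simp add: optimal_def)
    then have "E.stationary_cost (criterion E l) \<phi> \<le> k l - \<epsilon>"
      using l by (auto simp: feasE[OF \<phi>(1)])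
    then show "M.stationary_cost (criterion M l) \<phi> \<le> k l"
      using close[OF \<phi>(1), of l] err(1)[OF l] err(3) l by auto
  qed
  have lower: "ereal (M.stationary_cost (criterion M 0) \<phi>) \<le> avg_cost M (cost M) \<pi> + ereal \<kappa>"
    if \<pi>: "feasible M q k \<pi>" for \<pi>
  proof -
    have \<pi>p: "\<pi> \<in> policies M" using \<pi> by (simp add: feasible_def)
    note bnd = M.avg_cost_bounds[OF \<pi>p crit, of 0, simplified] M.avg_cost_bounds[OF slater(1) crit, of 0, simplified]
    obtain w where w: "avg_cost M (cost M) \<pi> = ereal w" "0 \<le> w"
      using bnd(1,2) by (cases "avg_cost M (cost M) \<pi>") (auto simp: criterion_def)
    (* eta is the precision of the stationary approximation: small enough that the weight r stays
       below 1 and that its own effect on the cost fits into the strict inequality for kappa *)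
    define \<eta> where "\<eta> = min (m - (\<epsilon> + e)) ((\<kappa> - (2 * err 0 + (\<epsilon> + e) / m * C 0)) / (1 + C 0 / m))"
    have den: "0 < 1 + C 0 / m" using C0 m(1) by (simp add: add_pos_nonneg)
    have \<eta>: "0 < \<eta>" "\<epsilon> + e + \<eta> \<le> m" "\<eta> * (1 + C 0 / m) \<le> \<kappa> - (2 * err 0 + (\<epsilon> + e) / m * C 0)"
    proof -
      show "0 < \<eta>" using err(4) \<kappa> den by (simp add: \<eta>_def)
      show "\<epsilon> + e + \<eta> \<le> m" by (simp add: \<eta>_def min_def)
      have "\<eta> \<le> (\<kappa> - (2 * err 0 + (\<epsilon> + e) / m * C 0)) / (1 + C 0 / m)" by (simp add: \<eta>_def)
      then show "\<eta> * (1 + C 0 / m) \<le> \<kappa> - (2 * err 0 + (\<epsilon> + e) / m * C 0)"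
        using den by (simp add: pos_le_divide_eq)
    qed
    define r where "r = (\<epsilon> + e + \<eta>) / m"
    have r: "0 \<le> r" "r \<le> 1" "r * m = \<epsilon> + e + \<eta>"
      using \<eta>(1,2) err m(1) by (auto simp: r_def)
    (* C 0 is a crude bound on the cost of the strictly feasible policy *)
    define v where "v l = (if l = 0 then w else k l)" for l
    define v' where "v' l = (if l = 0 then C 0 else k l - \<alpha>' l)" for l
    have "\<exists>\<psi>\<in>stationary_policies M. \<forall>l\<in>{..q}. M.stationary_cost (criterion M l) \<psi> \<le> (1 - r) * v l + r * v' l + \<eta>"
    proof (rule M.stationary_dominates_mixture[OF \<pi>p slater(1) r(1,2) _ _ Q Y h G L _ _ \<eta>(1)])
      show "avg_cost M (criterion M l) \<pi> \<le> ereal (v l)" if "l \<in> {..q}" for l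
        using that \<pi> w(1) by (auto simp: v_def criterion_def feasible_def)
      show "avg_cost M (criterion M l) \<pi>S \<le> ereal (v' l)" if "l \<in> {..q}" for l
        using that slater(2) bnd(4) by (auto simp: v'_def criterion_def)
    qed (use critb in auto)
    then obtain \<psi> where \<psi>: "\<psi> \<in> stationary_policies M"
      and \<psi>v: "\<And>l. l \<le> q \<Longrightarrow> M.stationary_cost (criterion M l) \<psi> \<le> (1 - r) * v l + r * v' l + \<eta>"
      by auto
    have "feasible E q (\<lambda>l. k l - \<epsilon>) (stationary \<psi>)"
      unfolding feasE[OF \<psi>]
    proof
      fix l assume l: "l \<in> {1..q}"
      have "E.stationary_cost (criterion E l) \<psi> \<le> M.stationary_cost (criterion M l) \<psi> + err l"
        using close[OF \<psi>, of l] l by auto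
      also have "\<dots> \<le> (1 - r) * k l + r * (k l - \<alpha>' l) + \<eta> + e"
        using \<psi>v[of l] err(1)[OF l] l by (auto simp: v_def v'_def)
      also have "\<dots> = k l - r * \<alpha>' l + \<eta> + e"
        by (simp add: algebra_simps)
      also have "\<dots> \<le> k l - r * m + \<eta> + e"
        using m(2)[OF l] r(1) by (simp add: mult_left_mono)
      finally show "E.stationary_cost (criterion E l) \<psi> \<le> k l - \<epsilon>" using r(3) by simp
    qed
    with \<phi>(2) have "avg_cost E (cost E) (stationary \<phi>) \<le> avg_cost E (cost E) (stationary \<psi>)"
      by (simp add: optimal_def)
    then have "E.stationary_cost (criterion E 0) \<phi> \<le> E.stationary_cost (criterion E 0) \<psi>"
      using avgE[OF \<phi>(1), of 0] avgE[OF \<psi>, of 0] by (simp add: criterion_def)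
    then have "M.stationary_cost (criterion M 0) \<phi> \<le> M.stationary_cost (criterion M 0) \<psi> + 2 * err 0"
      using close[OF \<phi>(1), of 0] close[OF \<psi>, of 0] by simp
    also have "\<dots> \<le> (1 - r) * w + r * C 0 + \<eta> + 2 * err 0"
      using \<psi>v[of 0] by (simp add: v_def v'_def)
    also have "\<dots> \<le> w + r * C 0 + \<eta> + 2 * err 0"
      using r(1) w(2) by (simp add: algebra_simps)
    also have "\<dots> = w + (\<epsilon> + e) / m * C 0 + \<eta> * (1 + C 0 / m) + 2 * err 0"
      using m(1) by (simp add: r_def field_simps)
    also have "\<dots> \<le> w + \<kappa>" using \<eta>(3) by simp
    finally show ?thesis by (simp add: w(1))
  qed
  have s: "avg_cost M (cost M) (stationary \<phi>) = ereal (M.stationary_cost (criterion M 0) \<phi>)"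
    using avgM[OF \<phi>(1), of 0] by (simp add: criterion_def)
  have up: "opt_value M q k \<le> ereal (M.stationary_cost (criterion M 0) \<phi>)"
    unfolding opt_value_def s[symmetric] by (rule INF_lower) (simp add: feas)
  have lo: "ereal (M.stationary_cost (criterion M 0) \<phi> - \<kappa>) \<le> opt_value M q k"
    unfolding opt_value_def
  proof (rule INF_greatest)
    fix \<pi> assume "\<pi> \<in> {\<pi>. feasible M q k \<pi>}"
    then show "ereal (M.stationary_cost (criterion M 0) \<phi> - \<kappa>) \<le> avg_cost M (cost M) \<pi>"
      using lower[of \<pi>] by (cases "avg_cost M (cost M) \<pi>") auto
  qed
  show "\<bar>avg_cost M (cost M) (stationary \<phi>) - opt_value M q k\<bar> \<le> ereal \<kappa>"
    unfolding s using up lo by (cases "opt_value M q k") auto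
qed

lemma err_I4_eq:
  assumes "C \<noteq> 0"
  shows "err_I4 R \<kappa>0 G \<alpha> C = G * \<alpha> / (R * ln (1 / \<kappa>0))"
  using assms by (simp add: err_I4_def err_I1_def err_I3_def)

text \<open>In the application, \<open>2 * G * \<delta>\<close> bounds the distance of the two transition laws; the first summand is \<open>C\<close> times the real
  minimum discussed before \<open>ceiling_trade_off\<close>. The inequality in the second part says that the
  minimizer is nonnegative.\<close>

lemma err_eps_eq:
  fixes n N :: nat
  assumes R: "0 < R" and \<kappa>0: "0 < \<kappa>0" "\<kappa>0 < 1" and C: "C \<noteq> 0" and n: "1 \<le> n"
    and G: "0 < G" and \<alpha>: "0 < \<alpha>"
  defines "\<delta> \<equiv> \<alpha> * (1 / real n) powr (1 / real N)"
  shows "err_eps R \<kappa>0 G \<alpha> N C L n =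
    C * (2 * G * \<delta> / ln (1 / \<kappa>0) * (1 + ln (2 * R * ln (1 / \<kappa>0) / (2 * G * \<delta>)))) + 2 * L * \<delta>"
    and "err_I4 R \<kappa>0 G \<alpha> C \<le> real n powr (1 / real N) \<longleftrightarrow> 2 * G * \<delta> \<le> 2 * R * ln (1 / \<kappa>0)"
proof -
  define l where "l = ln (1 / \<kappa>0)"
  define s where "s = real n powr (1 / real N)"
  have l: "0 < l" using \<kappa>0 by (simp add: l_def)
  have s: "0 < s" using n by (simp add: s_def)
  have inv: "(1 / real n) powr (1 / real N) = 1 / s"
    using n by (simp add: s_def powr_divide)
  have I4: "err_I4 R \<kappa>0 G \<alpha> C = G * \<alpha> / (R * l)"
    using err_I4_eq[OF C] by (simp add: l_def)
  have arg: "s / (G * \<alpha> / (R * l)) = 2 * R * l / (2 * G * (\<alpha> * (1 / s)))"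
    using s G \<alpha> by simp
  show "err_eps R \<kappa>0 G \<alpha> N C L n =
    C * (2 * G * \<delta> / ln (1 / \<kappa>0) * (1 + ln (2 * R * ln (1 / \<kappa>0) / (2 * G * \<delta>)))) + 2 * L * \<delta>"
    unfolding err_eps_def \<delta>_def I4 inv s_def[symmetric] l_def[symmetric] arg
    using R C l s by (simp add: err_I1_def err_I2_def err_I3_def field_simps)
  show "err_I4 R \<kappa>0 G \<alpha> C \<le> real n powr (1 / real N) \<longleftrightarrow> 2 * G * \<delta> \<le> 2 * R * ln (1 / \<kappa>0)"
    unfolding \<delta>_def I4 inv s_def[symmetric] l_def[symmetric]
    using R l s by (simp add: field_simps)
qed

theorem theorem10:
  fixes X :: "'s::euclidean_space set"
    and A :: "'a::metric_space set"
    and p :: "'s \<times> 'a \<Rightarrow> 's measure"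
    and c :: "'s \<times> 'a \<Rightarrow> real"
    and d :: "nat \<Rightarrow> 's \<times> 'a \<Rightarrow> real"
    and q :: nat
    and \<gamma> :: "'s measure"
    and k \<alpha>' :: "nat \<Rightarrow> real"
    and Y :: "nat \<Rightarrow> 's set"
    and Q :: "nat \<Rightarrow> 's \<Rightarrow> 's"
    and \<nu> :: "nat \<Rightarrow> 's measure"
    and Kc :: real and Kd :: "nat \<Rightarrow> real"
    and Gp \<alpha> R \<kappa>0 K \<kappa> \<epsilon> :: real
    and n :: nat
    and \<phi> :: "'s \<Rightarrow> 'a measure"
    and M :: "('s, 'a) cmdp" and Mfin Mext :: "nat \<Rightarrow> ('s, 'a) cmdp"
  assumes X: "compact X" and A: "compact A"
    and p_kernel: "p \<in> (restrict_space borel X \<Otimes>\<^sub>M restrict_space borel A)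
                        \<rightarrow>\<^sub>M prob_algebra (restrict_space borel X)"
    and c: "continuous_on (X \<times> A) c" "\<And>z. z \<in> X \<times> A \<Longrightarrow> 0 \<le> c z"
    and q: "1 \<le> q"
    and d: "\<And>l. l \<in> {1..q} \<Longrightarrow> continuous_on (X \<times> A) (d l)"
           "\<And>l z. l \<in> {1..q} \<Longrightarrow> z \<in> X \<times> A \<Longrightarrow> 0 \<le> d l z"
    and \<gamma>: "\<gamma> \<in> space (prob_algebra (restrict_space borel X))"
    and k: "\<And>l. l \<in> {1..q} \<Longrightarrow> 0 \<le> k l"
    and M: "M = original_model X A \<gamma> p c d"
    and \<alpha>'_pos: "\<And>l. l \<in> {1..q} \<Longrightarrow> 0 < \<alpha>' l"
    and slater: "\<exists>\<pi>\<in>policies M. \<forall>l\<in>{1..q}. avg_cost M (d l) \<pi> + ereal (\<alpha>' l) = ereal (k l)"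
    and \<alpha>: "0 < \<alpha>"
    and grid: "\<And>i. 1 \<le> i \<Longrightarrow> finite (Y i) \<and> card (Y i) = i \<and> Y i \<subseteq> X"
    and grid_dense: "\<And>i x. 1 \<le> i \<Longrightarrow> x \<in> X \<Longrightarrow>
                       Min (dist x ` Y i) \<le> \<alpha> * (1 / real i) powr (1 / real DIM('s))"
    and Q: "\<And>i. 1 \<le> i \<Longrightarrow> quantizer X (Y i) (Q i)"
    and \<nu>: "\<And>i. 1 \<le> i \<Longrightarrow> sets (\<nu> i) = sets (restrict_space borel X) \<and> finite_measure (\<nu> i)"
    and \<nu>_pos: "\<And>i y. 1 \<le> i \<Longrightarrow> y \<in> Y i \<Longrightarrow> 0 < emeasure (\<nu> i) (cell X (Q i) y)"
    and Mfin: "\<And>i. Mfin i = finite_model (Y i) (Q i) (\<nu> i) X A \<gamma> p c d"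
    and Mext: "\<And>i. Mext i = extended_model (Q i) (\<nu> i) X A \<gamma> p c d"
    and p_cont: "tv_continuous_on (X \<times> A) p"
    and p_minor: "minorized (restrict_space borel X) (restrict_space borel A) p"
    and c_lip: "\<And>a. a \<in> A \<Longrightarrow> Kc-lipschitz_on X (\<lambda>x. c (x, a))"
    and d_lip: "\<And>l a. l \<in> {1..q} \<Longrightarrow> a \<in> A \<Longrightarrow> (Kd l)-lipschitz_on X (\<lambda>x. d l (x, a))"
    and p_lip: "\<And>x y a. x \<in> X \<Longrightarrow> y \<in> X \<Longrightarrow> a \<in> A \<Longrightarrow>
                  tv_dist (p (x, a)) (p (y, a)) \<le> Gp * dist x y"
    and R: "0 < R" and \<kappa>0: "0 < \<kappa>0" "\<kappa>0 < 1"
    and ergodic: "uniformly_ergodic M R \<kappa>0" "\<And>i. 1 \<le> i \<Longrightarrow> uniformly_ergodic (Mext i) R \<kappa>0"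
    and I4_pos: "0 < err_I4 R \<kappa>0 Gp \<alpha> (sup_norm_on (X \<times> A) c)"
                "\<And>l. l \<in> {1..q} \<Longrightarrow> 0 < err_I4 R \<kappa>0 Gp \<alpha> (sup_norm_on (X \<times> A) (d l))"
    and K: "K = 2 * sup_norm_on (X \<times> A) c / Min (\<alpha>' ` {1..q})"
    and \<kappa>: "0 < \<kappa>"
    and \<epsilon>: "\<epsilon> = \<kappa> / (3 * K)" "\<epsilon> < 1 / 2 * Min (\<alpha>' ` {1..q})"
    and n: "1 \<le> n"
    and n_log: "err_I4 R \<kappa>0 Gp \<alpha> (sup_norm_on (X \<times> A) c) \<le> real n powr (1 / real DIM('s))"
    and n_large: "\<kappa> / 3 \<ge> 2 * err_eps R \<kappa>0 Gp \<alpha> DIM('s) (sup_norm_on (X \<times> A) c) Kc n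
                     + max (2 * K) 1 *
                       Max ((\<lambda>l. err_eps R \<kappa>0 Gp \<alpha> DIM('s) (sup_norm_on (X \<times> A) (d l)) (Kd l) n) ` {1..q})"
    and \<phi>: "\<phi> \<in> stationary_policies (Mfin n)"
           "optimal (Mfin n) q (\<lambda>l. k l - \<epsilon>) (stationary \<phi>)"
    and \<phi>_ext: "optimal (Mext n) q (\<lambda>l. k l - \<epsilon>) (stationary (\<lambda>x. \<phi> (Q n x)))"
  shows "(\<lambda>x. \<phi> (Q n x)) \<in> stationary_policies M
       \<and> feasible M q k (stationary (\<lambda>x. \<phi> (Q n x)))
       \<and> \<bar>avg_cost M c (stationary (\<lambda>x. \<phi> (Q n x))) - opt_value M q k\<bar> \<le> ereal \<kappa>"
proof -
  let ?S = "restrict_space (borel :: 's measure) X" and ?A = "restrict_space (borel :: 'a measure) A"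
  let ?N = "DIM('s)"
  define f where "f = criterion M"
  define Lf where "Lf l = (if l = 0 then Kc else Kd l)" for l
  define C where "C l = sup_norm_on (X \<times> A) (f l)" for l
  define h where "h i = \<alpha> * (1 / real i) powr (1 / real ?N)" for i :: nat
  have f_0: "f 0 = c"
    by (simp add: f_def criterion_def M original_model_def)
  have fl: "f l = d l" if "l \<in> {1..q}" for l
    using that by (auto simp: f_def criterion_def M original_model_def)
  have model: "states M = ?S" "actions M = ?A" "trans M = p" "init M = \<gamma>" "cost M = c" "constr M = d"
    by (simp_all add: M original_model_def)
  have sp: "space ?S = X" "space ?A = A" "space (?S \<Otimes>\<^sub>M ?A) = X \<times> A"
    by (simp_all add: space_restrict_space space_pair_measure)
  have Mk: "controlled_model M"
    using p_kernel \<gamma> by unfold_locales (simp_all add: model)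
  have Me: "ergodic_model M R \<kappa>0"
    using Mk ergodic(1) \<kappa>0 by (simp add: ergodic_model_def ergodic_model_axioms_def)
  interpret M: ergodic_model M R \<kappa>0 by (rule Me)
  obtain \<pi>S where \<pi>S: "\<pi>S \<in> policies M" "\<And>l. l \<in> {1..q} \<Longrightarrow> avg_cost M (d l) \<pi>S + ereal (\<alpha>' l) = ereal (k l)"
    using slater by blast

  have grid': "finite (Y i)" "Y i \<subseteq> X" "Q i \<in> ?S \<rightarrow>\<^sub>M count_space (Y i)" "x \<in> X \<Longrightarrow> dist x (Q i x) \<le> h i"
    if i: "1 \<le> i" for i x
  proof -
    show fin: "finite (Y i)" and "Y i \<subseteq> X" using grid[OF i] by auto
    show "Q i \<in> ?S \<rightarrow>\<^sub>M count_space (Y i)" using Q[OF i] by (simp add: quantizer_def)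
    assume x: "x \<in> X"
    have "Y i \<noteq> {}" using grid[OF i] i by auto
    then have "Min (dist x ` Y i) \<in> dist x ` Y i" using fin by (intro Min_in) auto
    then obtain y where "y \<in> Y i" "Min (dist x ` Y i) = dist x y" by auto
    then show "dist x (Q i x) \<le> h i"
      using Q[OF i] x grid_dense[OF i x] by (fastforce simp: quantizer_def h_def)
  qed
  have h: "h \<longlonglongrightarrow> 0"
  proof -
    have "(\<lambda>i. (1 / real i) powr (1 / real ?N)) \<longlonglongrightarrow> 0"
      by (rule tendsto_zero_powrI[OF lim_1_over_n tendsto_const]) auto
    then have "h \<longlonglongrightarrow> \<alpha> * 0"
      unfolding h_def by (intro tendsto_intros)
    then show ?thesis by simp
  qed
  have f: "continuous_on (X \<times> A) (f l)" "\<And>z. z \<in> X \<times> A \<Longrightarrow> 0 \<le> f l z"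
    "\<And>a. a \<in> A \<Longrightarrow> (Lf l)-lipschitz_on X (\<lambda>x. f l (x, a))" "0 < err_I4 R \<kappa>0 Gp \<alpha> (C l)"
    if "l \<le> q" for l
    using c d c_lip d_lip I4_pos f_0 fl[of l] that by (cases "l = 0"; auto simp: Lf_def C_def)+
  have f_meas: "f l \<in> borel_measurable (?S \<Otimes>\<^sub>M ?A)" if "l \<le> q" for l
    using caratheodory_lipschitz_measurable[OF grid'(3,1,2) h grid'(4) f(1,3)[OF that]] by blast
  have f_le: "f l z \<le> C l" if "l \<le> q" "z \<in> X \<times> A" for l z
  proof -
    have "compact ((\<lambda>z. \<bar>f l z\<bar>) ` (X \<times> A))"
      using f(1)[OF that(1)] X A by (intro compact_continuous_image compact_Times continuous_intros)
    then have "bdd_above ((\<lambda>z. \<bar>f l z\<bar>) ` (X \<times> A))"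
      by (intro bounded_imp_bdd_above compact_imp_bounded)
    then have "\<bar>f l z\<bar> \<le> C l"
      unfolding C_def sup_norm_on_def using that(2) by (intro cSUP_upper)
    then show ?thesis by simp
  qed
  have f_bm: "f l \<in> bounded_meas (?S \<Otimes>\<^sub>M ?A) (C l)" if "l \<le> q" for l
    using f_meas f(2) f_le that by (intro bounded_measI) (auto simp: sp abs_of_nonneg)
  have C_pos: "0 < C l" if "l \<le> q" for l
  proof -
    have "0 \<le> C l"
      using bounded_meas_nonneg[OF M.occupation_prob[OF \<pi>S(1)]] f_bm[OF that] by (simp add: model)
    (* for C l = 0 the quotient in err_I4 would have denominator 0 and hence the value 0 *)
    moreover have "C l \<noteq> 0"
      using f(4)[OF that] by (auto simp: err_I4_def err_I1_def err_I3_def)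
    ultimately show ?thesis by simp
  qed
  have lnk: "0 < ln (1 / \<kappa>0)" using \<kappa>0 by simp
  have I4: "err_I4 R \<kappa>0 Gp \<alpha> (C l) = Gp * \<alpha> / (R * ln (1 / \<kappa>0))" if "l \<le> q" for l
    using err_I4_eq C_pos[OF that] by simp
  have Gp: "0 < Gp"
  proof -
    have "0 < R * ln (1 / \<kappa>0)" using R lnk by (rule mult_pos_pos)
    then have "0 < Gp * \<alpha>" using f(4)[of 0] I4[of 0] by (simp only: zero_less_divide_iff) auto
    then show ?thesis using \<alpha> by (simp add: zero_less_mult_iff)
  qed

  interpret qz: quantization X A "Q n" "\<nu> n" "Y n" "h n"
    by (rule quantization.intro[OF grid'(3,4)[OF n] conjunct1[OF \<nu>[OF n]] conjunct2[OF \<nu>[OF n]] \<nu>_pos[OF n]])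
  have ext: "states (Mext n) = states M" "actions (Mext n) = actions M"
    "trans (Mext n) = (\<lambda>(x, a). qz.cell_of x \<bind> (\<lambda>z. p (z, a)))" "init (Mext n) = \<gamma>"
    by (simp_all add: Mext extended_model_def model)
  have ext_criterion: "criterion (Mext n) l = qz.cell_average (f l)" for l
    by (cases "l = 0") (simp_all add: criterion_def f_def qz.cell_average_def Mext extended_model_def model)
  have Ek: "controlled_model (Mext n)"
    using qz.extended_trans[OF p_kernel] \<gamma> by unfold_locales (simp_all add: ext model)
  have Ee: "ergodic_model (Mext n) R \<kappa>0"
    using Ek ergodic(2)[OF n] \<kappa>0 by (simp add: ergodic_model_def ergodic_model_axioms_def)

  define err where "err l = err_eps R \<kappa>0 Gp \<alpha> ?N (C l) (Lf l) n" for l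
  define D where "D = 2 * Gp * h n"
  have hn: "0 < h n" using \<alpha> n by (simp add: h_def)
  have D: "0 < D" using Gp hn by (simp add: D_def)
  have err_eq: "err l = C l * (D / ln (1 / \<kappa>0) * (1 + ln (2 * R * ln (1 / \<kappa>0) / D))) + 2 * Lf l * h n"
    if "l \<le> q" for l
    unfolding err_def D_def h_def using err_eps_eq(1)[OF R \<kappa>0 _ n Gp \<alpha>] C_pos[OF that] by simp
  (* err_I4 has the same value for all criteria, so one comparison covers them all *)
  have D_le: "D \<le> 2 * R * ln (1 / \<kappa>0)"
    using n_log err_eps_eq(2)[OF R \<kappa>0 _ n Gp \<alpha>, of "C 0" ?N] C_pos[of 0]
    by (simp add: D_def h_def C_def f_0)
  have A_ne: "A \<noteq> {}"
    using prob_algebraD(5)[OF M.occupation_prob[OF \<pi>S(1)]] by (auto simp: model sp)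
  have L_nonneg: "0 \<le> Lf l" if "l \<le> q" for l
  proof -
    obtain a where "a \<in> A" using A_ne by auto
    then show ?thesis by (rule lipschitz_on_nonneg[OF f(3)[OF that]])
  qed
  have err_nonneg: "0 \<le> err l" if l: "l \<le> q" for l
  proof -
    have "0 \<le> ln (2 * R * ln (1 / \<kappa>0) / D)"
      using D D_le by (intro ln_ge_zero) (simp add: le_divide_eq)
    then show ?thesis
      unfolding err_eq[OF l] using C_pos[OF l] D lnk hn L_nonneg[OF l] by (intro add_nonneg_nonneg mult_nonneg_nonneg) auto
  qed

  have close: "\<bar>M.stationary_cost (criterion M l) \<psi> - ergodic_model.stationary_cost (Mext n) (criterion (Mext n) l) \<psi>\<bar> \<le> err l"
    if \<psi>: "\<psi> \<in> stationary_policies M" and l: "l \<le> q" for \<psi> l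
  proof -
    obtain t where t: "1 \<le> t" "real t * min D (2 * R * \<kappa>0) + R * \<kappa>0 ^ t
        \<le> 2 * (D / ln (1 / \<kappa>0) * (1 + ln (2 * R * ln (1 / \<kappa>0) / D)))"
      using ceiling_trade_off[OF R \<kappa>0 D D_le] by blast
    have "\<bar>M.stationary_cost (criterion M l) \<psi> - ergodic_model.stationary_cost (Mext n) (criterion (Mext n) l) \<psi>\<bar>
        \<le> C l / 2 * (real t * min D (2 * R * \<kappa>0) + R * \<kappa>0 ^ t) + 2 * Lf l * h n"
    proof (rule stationary_cost_perturbation[OF Me Ee ext(1,2) \<psi> _ _ _ _ _ _ t(1)])
      fix z assume "z \<in> space (sa_space M)"
      then obtain x a where z: "z = (x, a)" "x \<in> X" "a \<in> A" by (auto simp: model sp)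
      show "tv_dist (trans (Mext n) z) (trans M z) \<le> min D (2 * R * \<kappa>0)"
        unfolding z(1) ext model prod.case
      proof (rule qz.tv_dist_extended_trans[OF p_kernel _ z(2,3)])
        fix y assume y: "y \<in> X" "Q n y = Q n x"
        have "tv_dist (p (y, a)) (p (x, a)) \<le> Gp * dist y x"
          by (rule p_lip[OF y(1) z(2,3)])
        also have "\<dots> \<le> D"
          using qz.cell_diameter[OF y(1) z(2) y(2)] Gp by (simp add: D_def)
        finally show "tv_dist (p (y, a)) (p (x, a)) \<le> min D (2 * R * \<kappa>0)"
          using M.tv_dist_trans_le[of y x a] y(1) z(2,3) by (simp add: model sp)
      qed
      show "0 \<le> criterion M l z" "criterion M l z \<le> C l"
        using z f(2)[OF l, of z] f_le[OF l, of z] by (auto simp: f_def)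
      show "\<bar>criterion M l z - criterion (Mext n) l z\<bar> \<le> 2 * Lf l * h n"
        using qz.cell_average_close[OF f_bm[OF l] f(3)[OF l] z(2,3)] unfolding z(1) ext_criterion by (simp add: f_def)
    qed (use f_meas[OF l] qz.cell_average_bounded_meas[OF f_bm[OF l]] in \<open>simp_all add: ext ext_criterion model f_def\<close>)
    also have "\<dots> \<le> C l / 2 * (2 * (D / ln (1 / \<kappa>0) * (1 + ln (2 * R * ln (1 / \<kappa>0) / D)))) + 2 * Lf l * h n"
      using t(2) C_pos[OF l] by (intro add_right_mono mult_left_mono) simp_all
    also have "\<dots> = err l" by (simp add: err_eq[OF l])
    finally show ?thesis .
  qed

  define m where "m = Min (\<alpha>' ` {1..q})"
  define e where "e = Max (err ` {1..q})"
  have ne: "{1..q} \<noteq> {}" using q by simp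
  have m: "0 < m" "\<And>l. l \<in> {1..q} \<Longrightarrow> m \<le> \<alpha>' l"
    using \<alpha>'_pos ne by (auto simp: m_def)
  have e: "\<And>l. l \<in> {1..q} \<Longrightarrow> err l \<le> e" by (simp add: e_def)
  have e0: "0 \<le> e" using e[of 1] err_nonneg[of 1] q by force
  have Km: "K = 2 * C 0 / m" using K by (simp add: C_def f_0 m_def)
  have Kpos: "0 < K" using C_pos[of 0] m(1) by (simp add: Km)
  have err_d: "err_eps R \<kappa>0 Gp \<alpha> ?N (sup_norm_on (X \<times> A) (d l)) (Kd l) n = err l" if "l \<in> {1..q}" for l
    using that fl[OF that] by (simp add: err_def C_def Lf_def)
  have large: "2 * err 0 + max (2 * K) 1 * e \<le> \<kappa> / 3"
  proof -
    have "(\<lambda>l. err_eps R \<kappa>0 Gp \<alpha> ?N (sup_norm_on (X \<times> A) (d l)) (Kd l) n) ` {1..q} = err ` {1..q}"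
      using err_d by (rule image_cong[OF refl])
    with n_large show ?thesis by (simp add: e_def err_def C_def Lf_def f_0)
  qed
  have "2 * K * e \<le> max (2 * K) 1 * e" using e0 by (intro mult_right_mono) auto
  then have Ke: "2 * err 0 + 2 * K * e \<le> \<kappa> / 3" using large by linarith
  then have "2 * K * e \<le> \<kappa> / 3" using err_nonneg[of 0] by simp
  then have e_le: "e \<le> \<epsilon> / 2" using Kpos by (simp add: \<epsilon>(1) field_simps)
  have \<epsilon>_pos: "0 < \<epsilon>" using \<kappa> Kpos by (simp add: \<epsilon>(1))
  (* K is chosen such that C 0 / m = K / 2, so the Slater mixture costs (eps + e) * K / 2 *)
  have "(\<epsilon> + e) / m * C 0 = (\<epsilon> + e) * K / 2" by (simp add: Km)
  also have "\<dots> = \<kappa> / 6 + K * e / 2" using Kpos by (simp add: \<epsilon>(1) field_simps)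
  also have "\<dots> \<le> \<kappa> / 6 + 2 * K * e" using Kpos e0 by simp
  finally have budget: "2 * err 0 + (\<epsilon> + e) / m * C 0 < \<kappa>" using Ke \<kappa> by linarith

  have st: "(\<lambda>x. \<phi> (Q n x)) \<in> stationary_policies M"
  proof -
    have "\<phi> \<in> count_space (Y n) \<rightarrow>\<^sub>M prob_algebra ?A"
      using \<phi>(1) by (simp add: stationary_policies_def Mfin finite_model_def)
    with measurable_compose[OF grid'(3)[OF n]] show ?thesis
      by (simp add: stationary_policies_def model)
  qed
  have slater': "avg_cost M (constr M l) \<pi>S \<le> ereal (k l - \<alpha>' l)" if "l \<in> {1..q}" for l
    using \<pi>S(2)[OF that] by (cases "avg_cost M (d l) \<pi>S") (auto simp: model)
  have Gh: "tv_dist (trans M (x, a)) (trans M (Q T x, a)) \<le> Gp * h T"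
    and Lh: "l \<le> q \<Longrightarrow> \<bar>criterion M l (x, a) - criterion M l (Q T x, a)\<bar> \<le> Lf l * h T"
    if "0 < T" "x \<in> space (states M)" "a \<in> space (actions M)" for T x a l
  proof -
    have T: "1 \<le> T" and x: "x \<in> X" and a: "a \<in> A" using that by (simp_all add: model sp)
    have Qx: "Q T x \<in> X"
      using measurable_space[OF grid'(3)[OF T], of x] grid'(2)[OF T] x by (auto simp: sp)
    note dx = grid'(4)[OF T x]
    have "Gp * dist x (Q T x) \<le> Gp * h T" using dx Gp by simp
    then show "tv_dist (trans M (x, a)) (trans M (Q T x, a)) \<le> Gp * h T"
      using p_lip[OF x Qx a] by (simp add: model)
    assume l: "l \<le> q"
    have "Lf l * dist x (Q T x) \<le> Lf l * h T" using dx L_nonneg[OF l] by (rule mult_left_mono)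
    then show "\<bar>criterion M l (x, a) - criterion M l (Q T x, a)\<bar> \<le> Lf l * h T"
      using lipschitz_onD[OF f(3)[OF l a] x Qx] by (simp add: f_def dist_real_def)
  qed
  have crit: "criterion M l \<in> borel_measurable (sa_space M)"
    "z \<in> space (sa_space M) \<Longrightarrow> 0 \<le> criterion M l z"
    "z \<in> space (sa_space M) \<Longrightarrow> criterion M l z \<le> C l"
    "criterion (Mext n) l \<in> bounded_meas (sa_space M) (C l)" if l: "l \<le> q" for l z
    unfolding ext ext_criterion model sp f_def[symmetric]
    by (rule f_meas[OF l] f(2)[OF l] f_le[OF l] qz.cell_average_bounded_meas[OF f_bm[OF l]]; assumption)+
  have quant: "Q T \<in> states M \<rightarrow>\<^sub>M count_space (Y T)" "finite (Y T)" "Y T \<subseteq> space (states M)" if "0 < T" for T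
    using grid'(1-3)[of T] that by (simp_all add: model sp)
  (* the tightening eps is at least twice the error of the constraints, and below m / 2 *)
  have slack: "e \<le> \<epsilon>" "\<epsilon> + e < m"
    using e_le \<epsilon>_pos \<epsilon>(2) by (simp_all add: m_def)
  note near = near_optimal_of_stationary_approximation[OF Me Ee ext(1,2) crit close quant h Gh Lh
      \<pi>S(1) slater' m e e0 slack budget st \<phi>_ext]
  have "feasible M q k (stationary (\<lambda>x. \<phi> (Q n x)))"
    by (rule near(1))
  moreover have "\<bar>avg_cost M (cost M) (stationary (\<lambda>x. \<phi> (Q n x))) - opt_value M q k\<bar> \<le> ereal \<kappa>"
    by (rule near(2))
  ultimately show ?thesis using st by (simp add: model)
qed

end
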